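(* Suppose LP1($Z$) is feasible and $Z,\Gamma$ satisfy $2\frac{OPT_1(Z)}{Z}\ge\frac{\Gamma}{2\sigma}\ge\frac{OPT_1(Z)}{Z}$. Then Algorithm Assign run with parameters $Z,\Gamma$ does not fail, and it returns a solution to LP1($Z$) (namely $\mathbf{x}$ together with $y_i=\Gamma\tilde y_i(\mathbf{x})$, $\lambda=\Gamma\tilde\lambda(\mathbf{x})$) of cost $O(\ln(mn)\ln(mn\rho))\,OPT_1(Z)$.
   Context: CCFL: facilities $[m]$ ($m\ge2$) with fixed charges $c_i\ge0$ known offline; $n\ge2$ clients arrive online, client $j$ revealing assignment costs $a_{ij}\ge0$ and capacity-normalized demands $p_{ij}\ge0$. $\rho=\max_j\frac{\max_i(c_i+p_{ij}+a_{ij})}{\min_i(c_i+p_{ij}+a_{ij})}$. For $Z>0$ let $F_j(Z)=\{i:c_i+p_{ij}+a_{ij}\le Z\}$. LP1($Z$): $\min\sum_ic_iy_i+Z\lambda+\sum_{i,j}a_{ij}x_{ij}$ s.t. $\sum_ix_{ij}\ge1$ for all $j$, $y_i\ge x_{ij}$, $Zy_i\ge\sum_jp_{ij}x_{ij}$, $\lambda\ge y_i$, $\lambda\ge1$, variables nonnegative, and $x_{ij}=0$ for $i\notin F_j(Z)$; $OPT_1(Z)$ is its optimal value. $\mu=1+\frac1{6\ln(emn)}$, $\sigma=4e^2\ln(2\mu mn\rho)$. Algorithm Assign($Z,\Gamma$): $\tilde w_i(\mathbf{x})=\max_jx_{ij}/\Gamma$, $\tilde v_i(\mathbf{x})=\sum_jp_{ij}x_{ij}/(Z\Gamma)$,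 $\tilde y_i=\tilde v_i+\tilde w_i$, $\tilde\lambda=\max_i\tilde y_i$; $\Phi(\mathbf{x})=\ln\sum_ie^{\sum_jp_{ij}x_{ij}/(Z\Gamma)}+\ln\sum_{i\in[m],j\in[n]}e^{x_{ij}/\Gamma}$; $\mathrm{cost}(\mathbf{x})=Z\Phi(\mathbf{x})+\sum_ic_i\tilde y_i(\mathbf{x})+\sum_{i,j}a_{ij}x_{ij}/\Gamma$; $r_{ij}(\mathbf{x})=Z\partial\Phi/\partial x_{ij}+\frac{c_i}{\Gamma}(\frac{p_{ij}}Z+1_{ij})+\frac{a_{ij}}{\Gamma}$, where $1_{ij}=1$ if $x_{ij}=\Gamma\tilde w_i(\mathbf{x})$ and $0$ otherwise; $\epsilon_j(\mathbf{x})=(\mu-1)\min_ir_{ij}(\mathbf{x})$; $x^0_{ij}=\frac1{2mn}\frac{\min_{i'}(c_{i'}+p_{i'j}+a_{i'j})}{c_i+p_{ij}+a_{ij}}$. Initially all $x_{ij}=0$. When client $j$ arrives: set $x_{ij}=x^0_{ij}$ for $i\in F_j(Z)$; while $\sum_ix_{ij}<1$ (a phase): with $\mathbf{x}^l$ the current vector, for each $i\in F_j(Z)$, if $\tilde w_i(\mathbf{x}^l)>x_{ij}/\Gamma$ set $x_{ij}\leftarrow\min\{\Gamma\tilde w_i(\mathbf{x}^l),x_{ij}(1+\epsilon_j(\mathbf{x}^l)/r_{ij}(\mathbf{x}^l))\}$, else $x_{ij}\leftarrow x_{ij}(1+\epsilon_j(\mathbf{x}^l)/r_{ij}(\mathbf{x}^l))$;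 then return FAIL if $\mathrm{cost}(\mathbf{x})>5Z\ln(emn)$.
   Formalization: The formal theorem takes λ = max(1, Γλ̃(x)) instead of λ = Γλ̃(x), since the latter can be below 1 and violate the constraint λ ≥ 1 (e.g. m=n=2, c=a=0, p=1, Z=100); it also assumes c_i+p_ij+a_ij > 0 so that ρ and x⁰ are defined. *)

theory Defs
  imports "HOL-Analysis.Analysis" "HOL-Library.While_Combinator"
begin

type_synonym matrix = "nat \<Rightarrow> nat \<Rightarrow> real"

datatype outcome = Diverge | Fail | Return matrix

text \<open>
  An instance of capacity constrained facility location. Facilities are the indices \<open>i < m\<close> and
  clients the indices \<open>j < n\<close>, numbered in order of arrival. Strict positivity of
  \<open>c i + p i j + a i j\<close> is what makes the ratio \<open>\<rho>\<close> below meaningful.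
\<close>
locale ccfl =
  fixes m n :: nat
    and c :: "nat \<Rightarrow> real"
    and p a :: matrix
  assumes m_ge_2: "2 \<le> m"
    and n_ge_2: "2 \<le> n"
    and c_nonneg: "i < m \<Longrightarrow> 0 \<le> c i"
    and p_nonneg: "i < m \<Longrightarrow> j < n \<Longrightarrow> 0 \<le> p i j"
    and a_nonneg: "i < m \<Longrightarrow> j < n \<Longrightarrow> 0 \<le> a i j"
    and total_pos: "i < m \<Longrightarrow> j < n \<Longrightarrow> 0 < c i + p i j + a i j"
begin

definition \<rho> :: real where
  "\<rho> = (MAX j\<in>{..<n}. (MAX i\<in>{..<m}. c i + p i j + a i j) / (MIN i\<in>{..<m}. c i + p i j + a i j))"

definition \<mu> :: real where
  "\<mu> = 1 + 1 / (6 * ln (exp 1 * real m * real n))"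

definition \<sigma> :: real where
  "\<sigma> = 4 * (exp 1)\<^sup>2 * ln (2 * \<mu> * real m * real n * \<rho>)"

definition allowed :: "real \<Rightarrow> nat \<Rightarrow> nat set" where
  "allowed Z j = {i. i < m \<and> c i + p i j + a i j \<le> Z}"

definition LP1_feasible :: "real \<Rightarrow> matrix \<Rightarrow> (nat \<Rightarrow> real) \<Rightarrow> real \<Rightarrow> bool" where
  "LP1_feasible Z x y l \<longleftrightarrow>
     (\<forall>j<n. (\<Sum>i<m. x i j) \<ge> 1) \<and>
     (\<forall>i<m. \<forall>j<n. y i \<ge> x i j) \<and>
     (\<forall>i<m. Z * y i \<ge> (\<Sum>j<n. p i j * x i j)) \<and>
     (\<forall>i<m. l \<ge> y i) \<and>
     l \<ge> 1 \<and>
     (\<forall>i<m. \<forall>j<n. x i j \<ge> 0) \<and> (\<forall>i<m. y i \<ge> 0) \<and> l \<ge> 0 \<and>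
     (\<forall>i<m. \<forall>j<n. i \<notin> allowed Z j \<longrightarrow> x i j = 0)"

definition LP1_cost :: "real \<Rightarrow> matrix \<Rightarrow> (nat \<Rightarrow> real) \<Rightarrow> real \<Rightarrow> real" where
  "LP1_cost Z x y l = (\<Sum>i<m. c i * y i) + Z * l + (\<Sum>i<m. \<Sum>j<n. a i j * x i j)"

definition OPT1 :: "real \<Rightarrow> real" where
  "OPT1 Z = Inf {LP1_cost Z x y l | x y l. LP1_feasible Z x y l}"

definition w_til :: "real \<Rightarrow> matrix \<Rightarrow> nat \<Rightarrow> real" where
  "w_til \<Gamma> x i = (MAX j\<in>{..<n}. x i j) / \<Gamma>"

definition v_til :: "real \<Rightarrow> real \<Rightarrow> matrix \<Rightarrow> nat \<Rightarrow> real" where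
  "v_til Z \<Gamma> x i = (\<Sum>j<n. p i j * x i j) / (Z * \<Gamma>)"

definition y_til :: "real \<Rightarrow> real \<Rightarrow> matrix \<Rightarrow> nat \<Rightarrow> real" where
  "y_til Z \<Gamma> x i = v_til Z \<Gamma> x i + w_til \<Gamma> x i"

text \<open>
  For the returned \<open>x\<close> the number \<open>\<Gamma> * lam_til Z \<Gamma> x\<close> can be smaller than \<open>1\<close>: with two identical
  facilities and small demands both fractions stay close to \<open>1/2\<close>. The value of \<open>\<lambda>\<close> that goes
  with \<open>x\<close> in LP1 is therefore \<open>max 1 (\<Gamma> * lam_til Z \<Gamma> x)\<close>.
\<close>
definition lam_til :: "real \<Rightarrow> real \<Rightarrow> matrix \<Rightarrow> real" where
  "lam_til Z \<Gamma> x = (MAX i\<in>{..<m}. y_til Z \<Gamma> x i)"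

definition \<Phi> :: "real \<Rightarrow> real \<Rightarrow> matrix \<Rightarrow> real" where
  "\<Phi> Z \<Gamma> x = ln (\<Sum>i<m. exp ((\<Sum>j<n. p i j * x i j) / (Z * \<Gamma>)))
            + ln (\<Sum>i<m. \<Sum>j<n. exp (x i j / \<Gamma>))"

definition cost :: "real \<Rightarrow> real \<Rightarrow> matrix \<Rightarrow> real" where
  "cost Z \<Gamma> x = Z * \<Phi> Z \<Gamma> x + (\<Sum>i<m. c i * y_til Z \<Gamma> x i)
              + (\<Sum>i<m. \<Sum>j<n. a i j * x i j / \<Gamma>)"

definition d\<Phi> :: "real \<Rightarrow> real \<Rightarrow> matrix \<Rightarrow> nat \<Rightarrow> nat \<Rightarrow> real" where
  "d\<Phi> Z \<Gamma> x i j = deriv (\<lambda>t. \<Phi> Z \<Gamma> (x(i := (x i)(j := t)))) (x i j)"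

definition r :: "real \<Rightarrow> real \<Rightarrow> matrix \<Rightarrow> nat \<Rightarrow> nat \<Rightarrow> real" where
  "r Z \<Gamma> x i j = Z * d\<Phi> Z \<Gamma> x i j
     + c i / \<Gamma> * (p i j / Z + of_bool (x i j = \<Gamma> * w_til \<Gamma> x i)) + a i j / \<Gamma>"

definition eps :: "real \<Rightarrow> real \<Rightarrow> matrix \<Rightarrow> nat \<Rightarrow> real" where
  "eps Z \<Gamma> x j = (\<mu> - 1) * (MIN i\<in>{..<m}. r Z \<Gamma> x i j)"

definition x0 :: matrix where
  "x0 i j = 1 / (2 * real m * real n)
     * ((MIN i'\<in>{..<m}. c i' + p i' j + a i' j) / (c i + p i j + a i j))"

definition arrive :: "real \<Rightarrow> nat \<Rightarrow> matrix \<Rightarrow> matrix" where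
  "arrive Z j x = (\<lambda>i k. if k = j \<and> i \<in> allowed Z j then x0 i j else x i k)"

text \<open>
  Within a phase the update of \<open>x i j\<close> depends only on the vector at the start of the phase, so
  all facilities are updated simultaneously.
\<close>
definition phase :: "real \<Rightarrow> real \<Rightarrow> nat \<Rightarrow> matrix \<Rightarrow> matrix" where
  "phase Z \<Gamma> j x = (\<lambda>i k.
     if k = j \<and> i \<in> allowed Z j then
       (let t = x i j * (1 + eps Z \<Gamma> x j / r Z \<Gamma> x i j)
        in if w_til \<Gamma> x i > x i j / \<Gamma> then min (\<Gamma> * w_til \<Gamma> x i) t else t)
     else x i k)"

text \<open>
  The Boolean component records that the failure test, made at the end of each phase, succeeded.
  The initial fractions of a client sum to less than \<open>1\<close>, so at least one phase takes place.
\<close>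
definition serve :: "real \<Rightarrow> real \<Rightarrow> nat \<Rightarrow> matrix \<Rightarrow> outcome" where
  "serve Z \<Gamma> j x =
     (case while_option
             (\<lambda>(x, failed). \<not> failed \<and> (\<Sum>i<m. x i j) < 1)
             (\<lambda>(x, _). let x' = phase Z \<Gamma> j x
                       in (x', cost Z \<Gamma> x' > 5 * Z * ln (exp 1 * real m * real n)))
             (arrive Z j x, False) of
        None \<Rightarrow> Diverge
      | Some (x', failed) \<Rightarrow> if failed then Fail else Return x')"

primrec run :: "real \<Rightarrow> real \<Rightarrow> nat \<Rightarrow> outcome" where
  "run Z \<Gamma> 0 = Return (\<lambda>_ _. 0)"
| "run Z \<Gamma> (Suc j) = (case run Z \<Gamma> j of Return x \<Rightarrow> serve Z \<Gamma> j x | other \<Rightarrow> other)"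

definition assign :: "real \<Rightarrow> real \<Rightarrow> outcome" where
  "assign Z \<Gamma> = run Z \<Gamma> n"

end

end

theory Submission
  imports Defs
begin

text \<open>
  Fix a solution \<open>xs, ys, ls\<close> of LP1 of cost at most twice the optimum. A phase raises the cost by at
  most \<open>2 * eps\<close>, and since \<open>xs\<close> covers the current client \<open>k\<close>, \<open>eps\<close> is at most the sum of
  \<open>xs i k * r i k * (eps / r i k)\<close>. The factors \<open>eps / r i k\<close> telescope, because \<open>x i k\<close> grows by
  \<open>1 + eps / r i k\<close> in all phases but at most one (the one in which the minimum caps it). The
  coefficients \<open>r i k\<close> contain softmax weights, which are not monotone in time; they are replaced by
  running maxima, whose sum exceeds \<open>1\<close> by at most the growth of the corresponding logarithm in
  \<open>\<Phi>\<close>. Hence the cost is bounded by a constant multiple of \<open>Z * ln (m * n)\<close> plus half of its own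
  growth, so the algorithm cannot fail; the same telescoping bounds the number of phases.
\<close>

text \<open>A phase costs at most \<open>2 * eps\<close> for this reason: to first order the cost
  grows at rate \<open>r i k\<close> in \<open>x i k\<close>, the step is at most
  \<open>x i k * eps / r i k\<close>, and the entries of a client still being served sum to less
  than 1. The factor 2 absorbs the higher-order error of the exponentials, whose exponents move by
  at most 1 in a step. The row maximum is not differentiable, but the cap lets it move only when the
  entry attains it, which is exactly when the indicator in \<open>r\<close> equals 1; so
  \<open>r\<close> is a correct rate there too. On allowed facilities the entries of an arrived
  client stay between \<open>\<theta>\<close> and \<open>\<mu>\<close>, so their logarithms grow by
  at most \<open>ln (\<mu> / \<theta>)\<close>. This is the logarithm in \<open>\<sigma>\<close>.
  Every \<open>r\<close> carries the factor \<open>1 / \<Gamma>\<close>, and the hypotheses make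
  \<open>Z * \<Gamma>\<close> at least 16 times that logarithm times the cost of
  \<open>xs, ys, ls\<close>; the \<open>1/2\<close> in the self-referential bound comes from
  there.\<close>

section \<open>Logarithms of sums of exponentials\<close>

text \<open>From \<open>exp d \<le> 1 + 2 * d\<close> on the unit interval and
  \<open>ln t \<le> t - 1\<close>. The weights on the right are those before the step, as in the
  \<open>r\<close> that a phase uses.\<close>

lemma ln_sum_exp_increment:
  fixes u d :: "'i \<Rightarrow> real"
  assumes I: "finite I" "I \<noteq> {}" and d: "\<And>i. i \<in> I \<Longrightarrow> 0 \<le> d i" "\<And>i. i \<in> I \<Longrightarrow> d i \<le> 1"
  shows "ln (\<Sum>i\<in>I. exp (u i + d i)) - ln (\<Sum>i\<in>I. exp (u i))
    \<le> 2 * (\<Sum>i\<in>I. d i * (exp (u i) / (\<Sum>i\<in>I. exp (u i))))"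
proof -
  define S where "S = (\<Sum>i\<in>I. exp (u i))"
  define S' where "S' = (\<Sum>i\<in>I. exp (u i + d i))"
  have S: "S > 0" and S': "S' > 0" unfolding S_def S'_def using I by (simp_all add: sum_pos)
  have "S' \<le> (\<Sum>i\<in>I. exp (u i) + 2 * (d i * exp (u i)))"
    unfolding S'_def
  proof (rule sum_mono)
    fix i assume i: "i \<in> I"
    have "exp (d i) \<le> 1 + d i + (d i)\<^sup>2" using d[OF i] by (rule exp_bound)
    also have "(d i)\<^sup>2 \<le> d i" using d[OF i] by (simp add: power2_eq_square mult_left_le)
    finally have "exp (d i) \<le> 1 + 2 * d i" by simp
    then have "exp (u i) * exp (d i) \<le> exp (u i) * (1 + 2 * d i)" by (intro mult_left_mono) auto
    then show "exp (u i + d i) \<le> exp (u i) + 2 * (d i * exp (u i))"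
      by (simp add: exp_add algebra_simps)
  qed
  then have le: "S' \<le> S + 2 * (\<Sum>i\<in>I. d i * exp (u i))"
    by (simp add: sum.distrib S_def sum_distrib_left)
  have "ln S' - ln S = ln (S' / S)" using S S' by (simp add: ln_div)
  also have "\<dots> \<le> S' / S - 1" using S S' by (intro ln_le_minus_one) auto
  also have "\<dots> \<le> 2 * (\<Sum>i\<in>I. d i * exp (u i)) / S"
    using le S by (simp add: pos_divide_le_eq pos_le_divide_eq diff_le_eq add_divide_distrib distrib_right)
  also have "\<dots> = 2 * (\<Sum>i\<in>I. d i * (exp (u i) / S))"
    by (simp flip: sum_divide_distrib)
  finally show ?thesis unfolding S_def S'_def .
qed

text \<open>Split a new weight \<open>exp (u' i) / S'\<close> into \<open>exp (u i) / S'\<close>,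
  which is at most the old weight because the sum only grows, and a nonnegative increment. The
  increments add up to \<open>1 - S / S'\<close>, which is at most
  \<open>ln (S' / S)\<close>.\<close>

lemma softmax_running_max:
  fixes u u' M :: "'i \<Rightarrow> real"
  assumes I: "finite I" "I \<noteq> {}" and u: "\<And>i. i \<in> I \<Longrightarrow> u i \<le> u' i"
    and M: "\<And>i. i \<in> I \<Longrightarrow> exp (u i) / (\<Sum>i\<in>I. exp (u i)) \<le> M i"
  shows "(\<Sum>i\<in>I. max (M i) (exp (u' i) / (\<Sum>i\<in>I. exp (u' i))))
    \<le> (\<Sum>i\<in>I. M i) + ln (\<Sum>i\<in>I. exp (u' i)) - ln (\<Sum>i\<in>I. exp (u i))"
proof -
  define S where "S = (\<Sum>i\<in>I. exp (u i))"
  define S' where "S' = (\<Sum>i\<in>I. exp (u' i))"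
  have S: "S > 0" and S': "S' > 0" unfolding S_def S'_def using I by (simp_all add: sum_pos)
  have SS: "S \<le> S'" unfolding S_def S'_def using u by (intro sum_mono) auto
  have "(\<Sum>i\<in>I. max (M i) (exp (u' i) / S')) \<le> (\<Sum>i\<in>I. M i + (exp (u' i) - exp (u i)) / S')"
  proof (rule sum_mono)
    fix i assume i: "i \<in> I"
    have "exp (u i) / S' \<le> exp (u i) / S" using S SS by (intro divide_left_mono) auto
    also have "\<dots> \<le> M i" using M[OF i] by (simp add: S_def)
    finally have "exp (u' i) / S' \<le> M i + (exp (u' i) - exp (u i)) / S'"
      by (simp add: diff_divide_distrib)
    moreover have "0 \<le> (exp (u' i) - exp (u i)) / S'" using S' u[OF i] by simp
    ultimately show "max (M i) (exp (u' i) / S') \<le> M i + (exp (u' i) - exp (u i)) / S'" by simp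
  qed
  also have "\<dots> = (\<Sum>i\<in>I. M i) + (S' - S) / S'"
    by (simp add: sum.distrib S_def S'_def sum_subtractf flip: sum_divide_distrib)
  also have "(S' - S) / S' \<le> - ln (S / S')"
    using ln_le_minus_one[of "S / S'"] S S' by (simp add: field_simps)
  also have "- ln (S / S') = ln S' - ln S" using S S' by (simp add: ln_div)
  finally show ?thesis unfolding S_def S'_def by simp
qed

text \<open>Turns the rate of a phase into logarithmic growth. Its factor 2, together with that of
  \<open>2 * eps\<close>, gives the 4 in \<open>phase_cost\<close>.\<close>

lemma le_two_ln_one_plus:
  fixes t :: real assumes "0 \<le> t" "t \<le> 1" shows "t \<le> 2 * ln (1 + t)"
proof -
  have "t / (1 + t) \<le> ln (1 + t)"
    using ln_le_minus_one[of "1 / (1 + t)"] assms by (simp add: ln_div field_simps)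
  moreover have "t / 2 \<le> t / (1 + t)" using assms by (intro divide_left_mono) auto
  ultimately show ?thesis by linarith
qed

section \<open>Constants of an instance\<close>

context ccfl
begin

abbreviation Lg :: real where "Lg \<equiv> ln (2 * \<mu> * real m * real n * \<rho>)"

abbreviation total :: matrix where "total i j \<equiv> c i + p i j + a i j"

lemma mn_ge_4: "4 \<le> real m * real n"
  using mult_mono[of 2 "real m" 2 "real n"] m_ge_2 n_ge_2 by simp

lemma ln_4_ge_1: "1 \<le> ln (4::real)"
proof -
  have "ln (exp 1) \<le> ln (4::real)" using exp_le by (subst ln_le_cancel_iff) auto
  then show ?thesis by simp
qed

lemma ln_mn_ge_1: "1 \<le> ln (real m * real n)"
proof -
  have "ln 4 \<le> ln (real m * real n)" using mn_ge_4 by (subst ln_le_cancel_iff) auto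
  then show ?thesis using ln_4_ge_1 by simp
qed

lemma ln_emn: "ln (exp 1 * real m * real n) = 1 + ln (real m * real n)"
  using m_ge_2 n_ge_2 by (simp add: ln_mult)

lemma \<mu>_gt_1: "1 < \<mu>"
  unfolding \<mu>_def ln_emn using ln_mn_ge_1 by simp

lemma \<mu>_le_2: "\<mu> \<le> 2"
  unfolding \<mu>_def ln_emn using ln_mn_ge_1 by simp

lemma index_ne: "{..<m} \<noteq> {}" "{..<n} \<noteq> {}"
  using m_ge_2 n_ge_2 by (auto simp: lessThan_empty_iff)

lemma min_total_le: "i < m \<Longrightarrow> (MIN i'\<in>{..<m}. total i' j) \<le> total i j"
  by (rule Min_le) auto

lemma min_total_pos: "j < n \<Longrightarrow> 0 < (MIN i'\<in>{..<m}. total i' j)"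
  using index_ne total_pos by (subst Min_gr_iff) auto

lemma total_over_min_le_\<rho>:
  assumes "i < m" "j < n" shows "total i j / (MIN i'\<in>{..<m}. total i' j) \<le> \<rho>"
proof -
  have "total i j \<le> (MAX i'\<in>{..<m}. total i' j)" using assms by (intro Max_ge) auto
  then have "total i j / (MIN i'\<in>{..<m}. total i' j)
      \<le> (MAX i'\<in>{..<m}. total i' j) / (MIN i'\<in>{..<m}. total i' j)"
    using min_total_pos[OF assms(2)] by (intro divide_right_mono) auto
  also have "\<dots> \<le> \<rho>" unfolding \<rho>_def using assms by (intro Max_ge) auto
  finally show ?thesis .
qed

lemma \<rho>_ge_1: "1 \<le> \<rho>"
proof -
  have 0: "0 < m" "0 < n" using m_ge_2 n_ge_2 by auto
  have "1 \<le> total 0 0 / (MIN i'\<in>{..<m}. total i' 0)"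
    using min_total_le[OF 0(1), of 0] min_total_pos[OF 0(2)] by simp
  also have "\<dots> \<le> \<rho>" using 0 by (rule total_over_min_le_\<rho>)
  finally show ?thesis .
qed

lemma Lg_ge_1: "1 \<le> Lg"
proof -
  have "4 * 1 \<le> (real m * real n) * (2 * \<mu> * \<rho>)"
    using mn_ge_4 \<mu>_gt_1 \<rho>_ge_1 mult_mono[of 1 "2 * \<mu>" 1 \<rho>] by (intro mult_mono) auto
  then have "ln 4 \<le> Lg" by (subst ln_le_cancel_iff) (auto simp: algebra_simps)
  then show ?thesis using ln_4_ge_1 by simp
qed

text \<open>A lower bound for the initial fractions that is uniform over facilities and clients,
  chosen so that \<open>ln (\<mu> / \<theta>) = Lg\<close>.\<close>

definition \<theta> :: real where "\<theta> = 1 / (2 * real m * real n * \<rho>)"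

lemma \<theta>_pos: "0 < \<theta>" unfolding \<theta>_def using m_ge_2 n_ge_2 \<rho>_ge_1 by simp

lemma \<theta>_le_1: "\<theta> \<le> 1"
proof -
  have "1 * 1 \<le> (real m * real n) * (2 * \<rho>)"
    using mn_ge_4 \<rho>_ge_1 by (intro mult_mono) auto
  then show ?thesis unfolding \<theta>_def using m_ge_2 n_ge_2 \<rho>_ge_1 by (simp add: field_simps)
qed

lemma ln_\<theta>: "- ln \<theta> + ln \<mu> = Lg"
  unfolding \<theta>_def using m_ge_2 n_ge_2 \<rho>_ge_1 \<mu>_gt_1 by (simp add: ln_mult ln_div)

lemma \<theta>_le_x0: assumes "i < m" "j < n" shows "\<theta> \<le> x0 i j"
proof -
  have "1 / \<rho> \<le> (MIN i'\<in>{..<m}. total i' j) / total i j"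
    using total_over_min_le_\<rho>[OF assms] min_total_pos[OF assms(2)] total_pos[OF assms] \<rho>_ge_1
    by (simp add: field_simps)
  then have "1 / (2 * real m * real n) * (1 / \<rho>) \<le> x0 i j"
    unfolding x0_def by (intro mult_left_mono) auto
  then show ?thesis by (simp add: \<theta>_def)
qed

lemma x0_le: assumes "i < m" "j < n" shows "x0 i j \<le> 1 / (2 * real m * real n)"
proof -
  have "(MIN i'\<in>{..<m}. total i' j) / total i j \<le> 1"
    using min_total_le[OF assms(1), of j] total_pos[OF assms] by simp
  then have "x0 i j \<le> 1 / (2 * real m * real n) * 1"
    unfolding x0_def by (intro mult_left_mono) auto
  then show ?thesis by simp
qed

lemma x0_pos: assumes "i < m" "j < n" shows "0 < x0 i j"
  using \<theta>_pos \<theta>_le_x0[OF assms] by simp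

end

section \<open>A run compared with a fixed solution of LP1\<close>

text \<open>A fixed feasible solution avoids asking whether the infimum \<open>OPT1\<close> is
  attained. The factor 16 in \<open>budget\<close> is twice the \<open>8 * Lg\<close> charged per
  client, so that the total charge becomes half of a quantity that grows with
  \<open>\<Phi>\<close>.\<close>

locale ccfl_run = ccfl +
  fixes Z \<Gamma> :: real and xs :: matrix and ys :: "nat \<Rightarrow> real" and ls :: real
  assumes Z_pos: "0 < Z"
    and feas: "LP1_feasible Z xs ys ls"
    and budget: "16 * ln (2 * \<mu> * real m * real n * \<rho>) * LP1_cost Z xs ys ls \<le> Z * \<Gamma>"
begin

abbreviation peak :: "matrix \<Rightarrow> nat \<Rightarrow> real" where "peak x i \<equiv> (MAX j\<in>{..<n}. x i j)"
abbreviation S1 :: "matrix \<Rightarrow> real" where "S1 x \<equiv> (\<Sum>i<m. exp (v_til Z \<Gamma> x i))"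
abbreviation S2 :: "matrix \<Rightarrow> real" where "S2 x \<equiv> (\<Sum>i<m. \<Sum>j<n. exp (x i j / \<Gamma>))"
definition sm1 :: "matrix \<Rightarrow> nat \<Rightarrow> real" where "sm1 x i = exp (v_til Z \<Gamma> x i) / S1 x"
definition sm2 :: "matrix \<Rightarrow> matrix" where "sm2 x i j = exp (x i j / \<Gamma>) / S2 x"

lemma feasD:
  "j < n \<Longrightarrow> 1 \<le> (\<Sum>i<m. xs i j)"
  "i < m \<Longrightarrow> j < n \<Longrightarrow> xs i j \<le> ys i"
  "i < m \<Longrightarrow> (\<Sum>j<n. p i j * xs i j) \<le> Z * ys i"
  "i < m \<Longrightarrow> ys i \<le> ls" "1 \<le> ls"
  "i < m \<Longrightarrow> j < n \<Longrightarrow> 0 \<le> xs i j" "i < m \<Longrightarrow> 0 \<le> ys i"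
  "i < m \<Longrightarrow> j < n \<Longrightarrow> i \<notin> allowed Z j \<Longrightarrow> xs i j = 0"
  using feas unfolding LP1_feasible_def by auto

lemma Z_le_cost: "Z \<le> LP1_cost Z xs ys ls"
proof -
  have "Z * 1 \<le> Z * ls" using feasD(5) Z_pos by (intro mult_left_mono) auto
  moreover have "0 \<le> (\<Sum>i<m. c i * ys i)" using c_nonneg feasD(7) by (intro sum_nonneg) auto
  moreover have "0 \<le> (\<Sum>i<m. \<Sum>j<n. a i j * xs i j)"
    using a_nonneg feasD(6) by (intro sum_nonneg) auto
  ultimately show ?thesis unfolding LP1_cost_def by simp
qed

lemma \<Gamma>_ge_16: "16 \<le> \<Gamma>"
proof -
  have "16 * 1 * Z \<le> 16 * Lg * LP1_cost Z xs ys ls"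
    using Lg_ge_1 Z_le_cost Z_pos by (intro mult_mono) auto
  also have "\<dots> \<le> \<Gamma> * Z" using budget by (simp add: mult.commute)
  finally show ?thesis using Z_pos by simp
qed

lemma \<Gamma>_pos: "0 < \<Gamma>" using \<Gamma>_ge_16 by simp

lemma S1_pos: "0 < S1 x" using index_ne by (intro sum_pos) auto
lemma S2_pos: "0 < S2 x" using index_ne by (intro sum_pos) auto

lemma S2_pairs: "S2 x = (\<Sum>q\<in>{..<m} \<times> {..<n}. exp (x (fst q) (snd q) / \<Gamma>))"
  by (simp add: sum.cartesian_product case_prod_unfold)

lemma pairs_ne: "finite ({..<m} \<times> {..<n})" "{..<m} \<times> {..<n} \<noteq> {}"
  using index_ne by auto

lemma sm1_pos: "0 < sm1 x i" unfolding sm1_def using S1_pos by simp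
lemma sm2_pos: "0 < sm2 x i j" unfolding sm2_def using S2_pos by simp

lemma sm1_le_1: assumes "i < m" shows "sm1 x i \<le> 1"
proof -
  have "exp (v_til Z \<Gamma> x i) \<le> S1 x" using assms by (intro member_le_sum) auto
  then show ?thesis unfolding sm1_def using S1_pos by simp
qed

lemma exp_entry_le_S2:
  assumes "i < m" "j < n" shows "exp (x i j / \<Gamma>) \<le> S2 x"
proof -
  have "exp (x i j / \<Gamma>) \<le> (\<Sum>j<n. exp (x i j / \<Gamma>))" using assms by (intro member_le_sum) auto
  also have "\<dots> \<le> S2 x" using assms
    by (intro member_le_sum[of i _ "\<lambda>i. \<Sum>j<n. exp (x i j / \<Gamma>)"]) (auto intro: sum_nonneg)
  finally show ?thesis .
qed

lemma sm2_le_1: assumes "i < m" "j < n" shows "sm2 x i j \<le> 1"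
  unfolding sm2_def using S2_pos exp_entry_le_S2[OF assms] by simp

lemma \<Phi>_eq: "\<Phi> Z \<Gamma> x = ln (S1 x) + ln (S2 x)"
  unfolding \<Phi>_def v_til_def ..

lemma \<Gamma>_w_til: "\<Gamma> * w_til \<Gamma> x i = peak x i"
  unfolding w_til_def using \<Gamma>_pos by simp

section \<open>The derivative of the potential and the coefficients \<open>r\<close>\<close>

lemma d\<Phi>_eq:
  assumes "i < m" "j < n"
  shows "d\<Phi> Z \<Gamma> x i j = p i j / (Z * \<Gamma>) * sm1 x i + sm2 x i j / \<Gamma>"
proof -
  define X where "X t = x(i := (x i)(j := t))" for t
  have X0: "X (x i j) = x" by (auto simp: X_def)
  have dX: "((\<lambda>t. X t i' j') has_field_derivative of_bool (i' = i \<and> j' = j)) (at t)" for i' j' t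
    by (cases "i' = i"; cases "j' = j") (simp_all add: X_def)
  have dv: "((\<lambda>t. (\<Sum>j'<n. p i' j' * X t i' j') / (Z * \<Gamma>)) has_field_derivative
      (\<Sum>j'<n. p i' j' * of_bool (i' = i \<and> j' = j)) / (Z * \<Gamma>)) (at t)" for i' t
    by (intro DERIV_cdivide DERIV_sum DERIV_cmult dX)
  have s: "(\<Sum>j'<n. p i' j' * of_bool (i' = i \<and> j' = j)) = p i j * of_bool (i' = i)" for i'
    using assms by (cases "i' = i") (simp_all add: of_bool_def if_distrib sum.delta cong: if_cong)
  have d1: "((\<lambda>t. \<Sum>i'<m. exp ((\<Sum>j'<n. p i' j' * X t i' j') / (Z * \<Gamma>))) has_field_derivative
      (\<Sum>i'<m. exp ((\<Sum>j'<n. p i' j' * X t i' j') / (Z * \<Gamma>)) * (p i j * of_bool (i' = i) / (Z * \<Gamma>)))) (at t)"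
    for t by (intro DERIV_sum DERIV_fun_exp dv[unfolded s])
  have d2: "((\<lambda>t. \<Sum>i'<m. \<Sum>j'<n. exp (X t i' j' / \<Gamma>)) has_field_derivative
      (\<Sum>i'<m. \<Sum>j'<n. exp (X t i' j' / \<Gamma>) * (of_bool (i' = i \<and> j' = j) / \<Gamma>))) (at t)" for t
    by (intro DERIV_sum DERIV_fun_exp DERIV_cdivide dX)
  have t1: "(\<Sum>i'<m. exp ((\<Sum>j'<n. p i' j' * x i' j') / (Z * \<Gamma>)) * (p i j * of_bool (i' = i) / (Z * \<Gamma>)))
      = exp (v_til Z \<Gamma> x i) * (p i j / (Z * \<Gamma>))"
  proof -
    have "exp ((\<Sum>j'<n. p i' j' * x i' j') / (Z * \<Gamma>)) * (p i j * of_bool (i' = i) / (Z * \<Gamma>))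
        = (if i' = i then exp (v_til Z \<Gamma> x i) * (p i j / (Z * \<Gamma>)) else 0)" for i'
      by (simp add: v_til_def)
    then show ?thesis using assms by (simp add: sum.delta)
  qed
  have t2: "(\<Sum>i'<m. \<Sum>j'<n. exp (x i' j' / \<Gamma>) * (of_bool (i' = i \<and> j' = j) / \<Gamma>))
      = exp (x i j / \<Gamma>) / \<Gamma>"
  proof -
    have "(\<Sum>j'<n. exp (x i' j' / \<Gamma>) * (of_bool (i' = i \<and> j' = j) / \<Gamma>))
        = (if i' = i then exp (x i j / \<Gamma>) / \<Gamma> else 0)" for i'
    proof -
      have "exp (x i' j' / \<Gamma>) * (of_bool (i' = i \<and> j' = j) / \<Gamma>)
          = (if j' = j then if i' = i then exp (x i j / \<Gamma>) / \<Gamma> else 0 else 0)" for j'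
        by simp
      then show ?thesis using assms by (simp add: sum.delta)
    qed
    then show ?thesis using assms by (simp add: sum.delta)
  qed
  have "((\<lambda>t. \<Phi> Z \<Gamma> (X t)) has_field_derivative
      1 / S1 x * (exp (v_til Z \<Gamma> x i) * (p i j / (Z * \<Gamma>))) + 1 / S2 x * (exp (x i j / \<Gamma>) / \<Gamma>))
      (at (x i j))"
    unfolding \<Phi>_def
  proof (rule DERIV_add)
    show "((\<lambda>t. ln (\<Sum>i'<m. exp ((\<Sum>j'<n. p i' j' * X t i' j') / (Z * \<Gamma>)))) has_field_derivative
      1 / S1 x * (exp (v_til Z \<Gamma> x i) * (p i j / (Z * \<Gamma>)))) (at (x i j))"
      using DERIV_chain2[OF DERIV_ln_divide d1[of "x i j"]] S1_pos[of x]
      unfolding X0 t1 by (simp add: v_til_def)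
    show "((\<lambda>t. ln (\<Sum>i'<m. \<Sum>j'<n. exp (X t i' j' / \<Gamma>))) has_field_derivative
      1 / S2 x * (exp (x i j / \<Gamma>) / \<Gamma>)) (at (x i j))"
      using DERIV_chain2[OF DERIV_ln_divide d2[of "x i j"]] S2_pos[of x]
      unfolding X0 t2 by simp
  qed
  then have "d\<Phi> Z \<Gamma> x i j
      = 1 / S1 x * (exp (v_til Z \<Gamma> x i) * (p i j / (Z * \<Gamma>))) + 1 / S2 x * (exp (x i j / \<Gamma>) / \<Gamma>)"
    unfolding d\<Phi>_def X_def by (rule DERIV_imp_deriv)
  then show ?thesis by (simp add: sm1_def sm2_def mult_ac)
qed

text \<open>This is \<open>r\<close> without its indicator part and with the softmax weights as
  parameters. It is increasing in both parameters, so running maxima can be substituted for the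
  weights.\<close>

definition R :: "(nat \<Rightarrow> real) \<Rightarrow> matrix \<Rightarrow> matrix" where
  "R P Q i j = (p i j * P i + Z * Q i j + c i * p i j / Z + a i j) / \<Gamma>"

lemma r_eq:
  assumes "i < m" "j < n"
  shows "r Z \<Gamma> x i j = R (sm1 x) (sm2 x) i j + c i / \<Gamma> * of_bool (x i j = peak x i)"
  unfolding r_def d\<Phi>_eq[OF assms] \<Gamma>_w_til R_def using Z_pos \<Gamma>_pos by (simp add: field_simps)

lemma R_mono:
  assumes "i < m" "j < n" "P i \<le> P' i" "Q i j \<le> Q' i j"
  shows "R P Q i j \<le> R P' Q' i j"
  unfolding R_def using assms p_nonneg Z_pos \<Gamma>_pos
  by (intro divide_right_mono add_mono[OF add_mono[OF add_mono]] mult_left_mono order_refl) auto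

lemma R_ge: 
  assumes "i < m" "j < n" "0 \<le> P i" shows "Z * Q i j / \<Gamma> \<le> R P Q i j"
  unfolding R_def using assms p_nonneg c_nonneg a_nonneg Z_pos \<Gamma>_pos
  by (intro divide_right_mono) auto

lemma r_ge: assumes "i < m" "j < n" shows "Z * sm2 x i j / \<Gamma> \<le> r Z \<Gamma> x i j"
proof -
  have "Z * sm2 x i j / \<Gamma> \<le> R (sm1 x) (sm2 x) i j"
    using sm1_pos[of x i] by (intro R_ge assms) auto
  moreover have "0 \<le> c i / \<Gamma> * of_bool (x i j = peak x i)" using c_nonneg assms \<Gamma>_pos by auto
  ultimately show ?thesis unfolding r_eq[OF assms] by linarith
qed

lemma r_pos: assumes "i < m" "j < n" shows "0 < r Z \<Gamma> x i j"
  using r_ge[OF assms, of x] sm2_pos[of x i j] Z_pos \<Gamma>_pos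
  by (smt (verit) divide_pos_pos mult_pos_pos)

lemma eps_pos: assumes "j < n" shows "0 < eps Z \<Gamma> x j"
  unfolding eps_def using \<mu>_gt_1 index_ne r_pos[OF _ assms]
  by (intro mult_pos_pos) (auto simp: Min_gr_iff)

lemma eps_le: assumes "i < m" "j < n" shows "eps Z \<Gamma> x j / r Z \<Gamma> x i j \<le> \<mu> - 1"
proof -
  have "(MIN i\<in>{..<m}. r Z \<Gamma> x i j) \<le> r Z \<Gamma> x i j" using assms by (intro Min_le) auto
  then have "eps Z \<Gamma> x j \<le> (\<mu> - 1) * r Z \<Gamma> x i j"
    unfolding eps_def using \<mu>_gt_1 by (intro mult_left_mono) auto
  then show ?thesis using r_pos[OF assms, of x] by (simp add: field_simps)
qed

section \<open>Running maxima of the softmax weights\<close>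

text \<open>
  \<open>P\<close> and \<open>Q\<close> stand for the running maxima of the two families of softmax weights; the subtracted
  logarithms are the value of \<open>\<Phi>\<close> at the zero matrix.
\<close>
definition tracks :: "(nat \<Rightarrow> real) \<Rightarrow> matrix \<Rightarrow> matrix \<Rightarrow> bool" where
  "tracks P Q x \<longleftrightarrow> (\<forall>i<m. sm1 x i \<le> P i) \<and> (\<forall>i<m. \<forall>j<n. sm2 x i j \<le> Q i j) \<and>
     (\<Sum>i<m. P i) + (\<Sum>i<m. \<Sum>j<n. Q i j) \<le> 2 + \<Phi> Z \<Gamma> x - ln (real m) - ln (real m * real n)"

text \<open>At the zero matrix the weights in each family are equal and sum to 1, so the bound in
  \<open>tracks\<close> is an equality.\<close>

lemma tracks_0: "tracks (\<lambda>i. 1 / real m) (\<lambda>i j. 1 / (real m * real n)) (\<lambda>i j. 0)"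
  using m_ge_2 n_ge_2 unfolding tracks_def \<Phi>_eq sm1_def sm2_def v_til_def by simp

lemma v_til_mono:
  assumes "i < m" "\<And>j. j < n \<Longrightarrow> x i j \<le> x' i j"
  shows "v_til Z \<Gamma> x i \<le> v_til Z \<Gamma> x' i"
  unfolding v_til_def using assms p_nonneg Z_pos \<Gamma>_pos
  by (intro divide_right_mono sum_mono mult_left_mono) auto

lemma tracks_mono:
  assumes t: "tracks P Q x" and le: "\<And>i j. i < m \<Longrightarrow> j < n \<Longrightarrow> x i j \<le> x' i j"
  obtains P' Q' where "tracks P' Q' x'" "\<And>i. P i \<le> P' i" "\<And>i j. Q i j \<le> Q' i j"
proof
  define P' where "P' i = max (P i) (sm1 x' i)" for i
  define Q' where "Q' i j = max (Q i j) (sm2 x' i j)" for i j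
  have "(\<Sum>i<m. P' i) \<le> (\<Sum>i<m. P i) + ln (S1 x') - ln (S1 x)"
    unfolding P'_def sm1_def using t v_til_mono le index_ne
    by (intro softmax_running_max) (auto simp: tracks_def sm1_def)
  moreover have "(\<Sum>i<m. \<Sum>j<n. Q' i j) \<le> (\<Sum>i<m. \<Sum>j<n. Q i j) + ln (S2 x') - ln (S2 x)"
    unfolding Q'_def sm2_def S2_pairs sum.cartesian_product case_prod_unfold
    using t le pairs_ne \<Gamma>_pos
    by (intro softmax_running_max) (auto simp: tracks_def sm2_def S2_pairs divide_right_mono)
  ultimately show "tracks P' Q' x'"
    using t unfolding tracks_def \<Phi>_eq by (auto simp: P'_def Q'_def)
qed auto

lemma tracks_nonneg:
  assumes "tracks P Q x" "i < m" shows "0 \<le> P i" "j < n \<Longrightarrow> 0 \<le> Q i j"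
  using assms sm1_pos[of x i] sm2_pos[of x i j] unfolding tracks_def by (force intro: order_trans[OF less_imp_le])+

section \<open>Row maxima and the cost of changing one column\<close>

lemma peak_ge: "j < n \<Longrightarrow> x i j \<le> peak x i"
  by (rule Max_ge) auto

lemma peak_update:
  assumes "k < n" "\<And>j. j < n \<Longrightarrow> j \<noteq> k \<Longrightarrow> x' i j = x i j" "x i k \<le> x' i k"
  shows "peak x' i = max (peak x i) (x' i k)"
proof (rule antisym)
  show "peak x' i \<le> max (peak x i) (x' i k)"
  proof (subst Max_le_iff)
    show "\<forall>z\<in>x' i ` {..<n}. z \<le> max (peak x i) (x' i k)"
    proof
      fix z assume "z \<in> x' i ` {..<n}"
      then obtain j where j: "j < n" "z = x' i j" by auto
      then show "z \<le> max (peak x i) (x' i k)"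
        using assms(2)[of j] peak_ge[of j x i] by (cases "j = k") (auto intro: max.coboundedI1)
    qed
  qed (use index_ne in auto)
  have "x i j \<le> peak x' i" if "j < n" for j
  proof -
    have "x i j \<le> x' i j" using that assms(2)[of j] assms(3) by (cases "j = k") auto
    also have "\<dots> \<le> peak x' i" using that by (rule peak_ge)
    finally show ?thesis .
  qed
  then have "peak x i \<le> peak x' i" using index_ne by (subst Max_le_iff) auto
  then show "max (peak x i) (x' i k) \<le> peak x' i" using peak_ge[OF assms(1)] by auto
qed

lemma cost_eq: "cost Z \<Gamma> x = Z * \<Phi> Z \<Gamma> x
    + (\<Sum>i<m. c i * v_til Z \<Gamma> x i + c i * peak x i / \<Gamma> + (\<Sum>j<n. a i j * x i j) / \<Gamma>)"
  unfolding cost_def y_til_def w_til_def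
  by (simp add: sum.distrib sum_divide_distrib distrib_left)

lemma sum_update:
  fixes f :: "nat \<Rightarrow> real"
  assumes "k < n" "\<And>j. j < n \<Longrightarrow> j \<noteq> k \<Longrightarrow> x' j = x j"
  shows "(\<Sum>j<n. f j * x' j) = (\<Sum>j<n. f j * x j) + f k * (x' k - x k)"
proof -
  have "(\<Sum>j<n. f j * x' j) - (\<Sum>j<n. f j * x j) = (\<Sum>j<n. f j * (x' j - x j))"
    by (simp add: sum_subtractf right_diff_distrib)
  also have "\<dots> = (\<Sum>j<n. if j = k then f k * (x' k - x k) else 0)"
    using assms by (intro sum.cong) auto
  also have "\<dots> = f k * (x' k - x k)" using assms by (simp add: sum.delta)
  finally show ?thesis by simp
qed

text \<open>The change of the row maximum stays a separate term because it is not smooth. Only the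
  logarithms need the factor 2; the linear terms receive it as well, so that everything fits
  \<open>R\<close>. The change of column \<open>k\<close> is arbitrary, so that both arrivals and
  phases are covered.\<close>

lemma cost_increment:
  assumes k: "k < n"
    and eq: "\<And>i j. i < m \<Longrightarrow> j < n \<Longrightarrow> j \<noteq> k \<Longrightarrow> x' i j = x i j"
    and d: "\<And>i. i < m \<Longrightarrow> 0 \<le> x' i k - x i k" "\<And>i. i < m \<Longrightarrow> x' i k - x i k \<le> 1"
      "\<And>i. i < m \<Longrightarrow> p i k * (x' i k - x i k) \<le> Z"
  shows "cost Z \<Gamma> x' - cost Z \<Gamma> x \<le> (\<Sum>i<m. 2 * (R (sm1 x) (sm2 x) i k * (x' i k - x i k))
    + c i * (peak x' i - peak x i) / \<Gamma>)"
proof -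
  define \<delta> where "\<delta> i = x' i k - x i k" for i
  note d = d[folded \<delta>_def]
  have v: "v_til Z \<Gamma> x' i = v_til Z \<Gamma> x i + p i k * \<delta> i / (Z * \<Gamma>)" if "i < m" for i
    unfolding v_til_def \<delta>_def using sum_update[OF k eq[OF that], where f = "p i"]
    by (simp add: that add_divide_distrib)
  have "ln (S1 x') - ln (S1 x) = ln (\<Sum>i<m. exp (v_til Z \<Gamma> x i + p i k * \<delta> i / (Z * \<Gamma>))) - ln (S1 x)"
    using v by simp
  also have "\<dots> \<le> 2 * (\<Sum>i<m. p i k * \<delta> i / (Z * \<Gamma>) * sm1 x i)"
    unfolding sm1_def
  proof (rule ln_sum_exp_increment)
    fix i assume i: "i \<in> {..<m}"
    then show "0 \<le> p i k * \<delta> i / (Z * \<Gamma>)" using d p_nonneg k Z_pos \<Gamma>_pos by simp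
    have "p i k * \<delta> i \<le> Z * 1" using d i by simp
    also have "\<dots> \<le> Z * \<Gamma>" using Z_pos \<Gamma>_ge_16 by (intro mult_left_mono) auto
    finally show "p i k * \<delta> i / (Z * \<Gamma>) \<le> 1" using Z_pos \<Gamma>_pos by simp
  qed (use index_ne in auto)
  finally have 1: "ln (S1 x') - ln (S1 x) \<le> 2 * (\<Sum>i<m. p i k * \<delta> i / (Z * \<Gamma>) * sm1 x i)" .
  \<comment> \<open>\<open>S2\<close> ranges over all pairs; extending the increment by 0 to the
    other columns makes the one-family estimate applicable.\<close>
  define D where "D q = (if snd q = k then \<delta> (fst q) / \<Gamma> else 0)" for q :: "nat \<times> nat"
  let ?I = "{..<m} \<times> {..<n}"
  have "S2 x' = (\<Sum>q\<in>?I. exp (x (fst q) (snd q) / \<Gamma> + D q))"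
    unfolding S2_pairs by (intro sum.cong) (auto simp: D_def \<delta>_def eq diff_divide_distrib)
  then have "ln (S2 x') - ln (S2 x) = ln (\<Sum>q\<in>?I. exp (x (fst q) (snd q) / \<Gamma> + D q)) - ln (S2 x)"
    by simp
  also have "\<dots> \<le> 2 * (\<Sum>q\<in>?I. D q * (exp (x (fst q) (snd q) / \<Gamma>) / S2 x))"
    unfolding S2_pairs
  proof (rule ln_sum_exp_increment)
    fix q assume "q \<in> ?I"
    then show "0 \<le> D q" "D q \<le> 1" using d[of "fst q"] \<Gamma>_ge_16 by (auto simp: D_def)
  qed (use pairs_ne in auto)
  also have "(\<Sum>q\<in>?I. D q * (exp (x (fst q) (snd q) / \<Gamma>) / S2 x))
      = (\<Sum>i<m. \<Sum>j<n. D (i, j) * sm2 x i j)"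
    by (simp add: sum.cartesian_product case_prod_unfold sm2_def)
  also have "\<dots> = (\<Sum>i<m. \<delta> i / \<Gamma> * sm2 x i k)"
  proof (intro sum.cong refl)
    fix i
    have "(\<Sum>j<n. D (i, j) * sm2 x i j) = (\<Sum>j<n. if j = k then \<delta> i / \<Gamma> * sm2 x i k else 0)"
      by (intro sum.cong) (auto simp: D_def)
    then show "(\<Sum>j<n. D (i, j) * sm2 x i j) = \<delta> i / \<Gamma> * sm2 x i k" using k by (simp add: sum.delta)
  qed
  finally have 2: "ln (S2 x') - ln (S2 x) \<le> 2 * (\<Sum>i<m. \<delta> i / \<Gamma> * sm2 x i k)" .
  have "Z * (\<Phi> Z \<Gamma> x' - \<Phi> Z \<Gamma> x)
      \<le> Z * (2 * (\<Sum>i<m. p i k * \<delta> i / (Z * \<Gamma>) * sm1 x i) + 2 * (\<Sum>i<m. \<delta> i / \<Gamma> * sm2 x i k))"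
    unfolding \<Phi>_eq using 1 2 Z_pos by (intro mult_left_mono) auto
  also have "\<dots> = (\<Sum>i<m. 2 * p i k * \<delta> i / \<Gamma> * sm1 x i + 2 * Z * \<delta> i / \<Gamma> * sm2 x i k)"
    using Z_pos by (simp add: sum_distrib_left sum.distrib distrib_left mult_ac)
  finally have 3: "Z * (\<Phi> Z \<Gamma> x' - \<Phi> Z \<Gamma> x)
    \<le> (\<Sum>i<m. 2 * p i k * \<delta> i / \<Gamma> * sm1 x i + 2 * Z * \<delta> i / \<Gamma> * sm2 x i k)" .
  have 4: "(\<Sum>i<m. c i * v_til Z \<Gamma> x' i + c i * peak x' i / \<Gamma> + (\<Sum>j<n. a i j * x' i j) / \<Gamma>)
      - (\<Sum>i<m. c i * v_til Z \<Gamma> x i + c i * peak x i / \<Gamma> + (\<Sum>j<n. a i j * x i j) / \<Gamma>)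
    = (\<Sum>i<m. c i * (p i k * \<delta> i / (Z * \<Gamma>)) + a i k * \<delta> i / \<Gamma> + c i * (peak x' i - peak x i) / \<Gamma>)"
    unfolding sum_subtractf[symmetric]
  proof (rule sum.cong)
    fix i assume "i \<in> {..<m}"
    then have i: "i < m" by simp
    have "(\<Sum>j<n. a i j * x' i j) = (\<Sum>j<n. a i j * x i j) + a i k * \<delta> i"
      unfolding \<delta>_def using sum_update[OF k eq[OF i], where f = "a i"] by (simp add: i)
    then show "c i * v_til Z \<Gamma> x' i + c i * peak x' i / \<Gamma> + (\<Sum>j<n. a i j * x' i j) / \<Gamma>
        - (c i * v_til Z \<Gamma> x i + c i * peak x i / \<Gamma> + (\<Sum>j<n. a i j * x i j) / \<Gamma>)
      = c i * (p i k * \<delta> i / (Z * \<Gamma>)) + a i k * \<delta> i / \<Gamma> + c i * (peak x' i - peak x i) / \<Gamma>"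
      by (simp add: v[OF i] add_divide_distrib diff_divide_distrib algebra_simps)
  qed simp
  have "cost Z \<Gamma> x' - cost Z \<Gamma> x
      \<le> (\<Sum>i<m. 2 * p i k * \<delta> i / \<Gamma> * sm1 x i + 2 * Z * \<delta> i / \<Gamma> * sm2 x i k)
      + (\<Sum>i<m. c i * (p i k * \<delta> i / (Z * \<Gamma>)) + a i k * \<delta> i / \<Gamma> + c i * (peak x' i - peak x i) / \<Gamma>)"
    using 3 4 unfolding cost_eq right_diff_distrib by linarith
  also have "\<dots> \<le> (\<Sum>i<m. 2 * (R (sm1 x) (sm2 x) i k * \<delta> i) + c i * (peak x' i - peak x i) / \<Gamma>)"
    unfolding sum.distrib[symmetric]
  proof (rule sum_mono)
    fix i assume "i \<in> {..<m}"
    then have "0 \<le> c i * p i k / Z / \<Gamma> * \<delta> i" "0 \<le> a i k / \<Gamma> * \<delta> i"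
      using c_nonneg p_nonneg a_nonneg d k Z_pos \<Gamma>_pos by auto
    moreover have "2 * (R (sm1 x) (sm2 x) i k * \<delta> i) = 2 * p i k * \<delta> i / \<Gamma> * sm1 x i
        + 2 * Z * \<delta> i / \<Gamma> * sm2 x i k + 2 * (c i * p i k / Z / \<Gamma> * \<delta> i) + 2 * (a i k / \<Gamma> * \<delta> i)"
      unfolding R_def by (simp add: add_divide_distrib algebra_simps)
    moreover have "c i * (p i k * \<delta> i / (Z * \<Gamma>)) = c i * p i k / Z / \<Gamma> * \<delta> i"
      "a i k * \<delta> i / \<Gamma> = a i k / \<Gamma> * \<delta> i" by simp_all
    ultimately show "2 * p i k * \<delta> i / \<Gamma> * sm1 x i + 2 * Z * \<delta> i / \<Gamma> * sm2 x i k
      + (c i * (p i k * \<delta> i / (Z * \<Gamma>)) + a i k * \<delta> i / \<Gamma> + c i * (peak x' i - peak x i) / \<Gamma>)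
      \<le> 2 * (R (sm1 x) (sm2 x) i k * \<delta> i) + c i * (peak x' i - peak x i) / \<Gamma>"
      by linarith
  qed
  finally show ?thesis unfolding \<delta>_def .
qed

text \<open>
  The term \<open>ln \<mu>\<close> makes up for the growth lost when \<open>x i k\<close> is capped at the row maximum: from then
  on it is itself the row maximum and is never capped again.
\<close>
definition gain :: "nat \<Rightarrow> matrix \<Rightarrow> nat \<Rightarrow> real" where
  "gain k x i = ln (x i k) + (if x i k = peak x i then ln \<mu> else 0) - ln (x0 i k)"

text \<open>The cutoff at \<open>\<theta>\<close> makes this start at 0 for an empty row and stay
  below \<open>Lg\<close>. Row maxima never fall, so one such allowance per facility serves all
  clients. Treating the indicator like a softmax weight, by its maximum over time, could charge
  \<open>c i\<close> once for every client.\<close>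

definition \<Omega> :: "matrix \<Rightarrow> nat \<Rightarrow> real" where
  "\<Omega> x i = ln (max \<theta> (peak x i)) - ln \<theta>"

section \<open>Effect of a single phase\<close>

abbreviation rate :: "nat \<Rightarrow> matrix \<Rightarrow> nat \<Rightarrow> real" where
  "rate k x i \<equiv> eps Z \<Gamma> x k / r Z \<Gamma> x i k"

lemma rate_bounds:
  assumes "i < m" "k < n" shows "0 < rate k x i" "rate k x i \<le> \<mu> - 1" "rate k x i \<le> 1"
proof -
  show "0 < rate k x i" using assms eps_pos r_pos by simp
  show "rate k x i \<le> \<mu> - 1" using assms by (rule eps_le)
  then show "rate k x i \<le> 1" using \<mu>_le_2 by linarith
qed

lemma allowedD: "i \<in> allowed Z j \<Longrightarrow> i < m" "i \<in> allowed Z j \<Longrightarrow> total i j \<le> Z"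
  unfolding allowed_def by auto

lemma phase_other: "j \<noteq> k \<Longrightarrow> phase Z \<Gamma> k x i j = x i j"
  "i \<notin> allowed Z k \<Longrightarrow> phase Z \<Gamma> k x i j = x i j"
  unfolding phase_def by auto

lemma phase_allowed:
  assumes "i \<in> allowed Z k"
  shows "phase Z \<Gamma> k x i k = (if x i k < peak x i then min (peak x i) (x i k * (1 + rate k x i))
    else x i k * (1 + rate k x i))"
proof -
  have "w_til \<Gamma> x i > x i k / \<Gamma> \<longleftrightarrow> x i k < peak x i"
    unfolding w_til_def using \<Gamma>_pos by (simp add: divide_less_cancel)
  then show ?thesis unfolding phase_def using assms by (simp add: \<Gamma>_w_til Let_def)
qed

lemma phase_bounds:
  assumes "i < m" "k < n" "0 \<le> x i k"
  shows "x i k \<le> phase Z \<Gamma> k x i k" "phase Z \<Gamma> k x i k \<le> x i k * (1 + rate k x i)"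
proof -
  have "x i k * 1 \<le> x i k * (1 + rate k x i)" 
    using assms rate_bounds(1)[OF assms(1,2), of x] by (intro mult_left_mono) auto
  then show "x i k \<le> phase Z \<Gamma> k x i k" "phase Z \<Gamma> k x i k \<le> x i k * (1 + rate k x i)"
    by (cases "i \<in> allowed Z k"; auto simp: phase_allowed phase_other)+
qed

text \<open>An entry below the row maximum is capped there, so it cannot push the maximum up. The
  factor \<open>of_bool\<close> is the indicator in \<open>r\<close>.\<close>

lemma phase_peak:
  assumes "i < m" "k < n" "0 \<le> x i k"
  shows "peak (phase Z \<Gamma> k x) i = peak x i + of_bool (x i k = peak x i) * (phase Z \<Gamma> k x i k - x i k)"
proof -
  have "peak (phase Z \<Gamma> k x) i = max (peak x i) (phase Z \<Gamma> k x i k)"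
    using assms phase_bounds(1)[of i k x] by (intro peak_update) (auto simp: phase_other)
  moreover have "phase Z \<Gamma> k x i k \<le> peak x i" if "x i k < peak x i"
    using that by (cases "i \<in> allowed Z k") (auto simp: phase_allowed phase_other)
  moreover have "x i k \<le> peak x i" using assms by (intro peak_ge)
  ultimately show ?thesis
    using phase_bounds(1)[of i k x] assms by (cases "x i k = peak x i") (auto simp: max_def)
qed

text \<open>Without capping the entry grows by exactly \<open>1 + rate\<close>, and one that attains
  the row maximum carries the maximum along and keeps its bonus. With capping the bonus
  \<open>ln \<mu>\<close> is at least \<open>ln (1 + rate)\<close>.\<close>

lemma gain_step:
  assumes "i \<in> allowed Z k" "k < n" "0 < x i k"
  shows "gain k x i + ln (1 + rate k x i) \<le> gain k (phase Z \<Gamma> k x) i"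
proof -
  let ?t = "x i k * (1 + rate k x i)"
  note i = allowedD(1)[OF assms(1)]
  note rate = rate_bounds[OF i assms(2), of x]
  have lnt: "ln ?t = ln (x i k) + ln (1 + rate k x i)" using assms rate by (simp add: ln_mult)
  have peak': "peak (phase Z \<Gamma> k x) i
      = peak x i + of_bool (x i k = peak x i) * (phase Z \<Gamma> k x i k - x i k)"
    using i assms by (intro phase_peak) auto
  have "ln (1 + rate k x i) \<le> ln \<mu>" using rate by (subst ln_le_cancel_iff) auto
  moreover have "0 \<le> ln \<mu>" using \<mu>_gt_1 by simp
  moreover have "x i k \<le> peak x i" using assms by (intro peak_ge)
  moreover have "ln (x i k) \<le> ln (peak x i)" if "x i k < peak x i"
    using that assms by (subst ln_le_cancel_iff) auto
  ultimately show ?thesis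
    using lnt peak' unfolding gain_def phase_allowed[OF assms(1), of x]
    by (cases "x i k = peak x i"; cases "peak x i \<le> ?t") (auto simp: min_def)
qed

text \<open>An allowed entry is at least \<open>\<theta>\<close>, so when it is the row maximum the
  cutoff hides none of its growth.\<close>

lemma \<Omega>_step:
  assumes "i < m" "k < n" "i \<in> allowed Z k \<Longrightarrow> \<theta> \<le> x i k" "0 \<le> x i k"
  shows "\<Omega> x i + of_bool (i \<in> allowed Z k \<and> x i k = peak x i) * ln (1 + rate k x i)
    \<le> \<Omega> (phase Z \<Gamma> k x) i"
proof (cases "i \<in> allowed Z k \<and> x i k = peak x i")
  case True
  then have "peak (phase Z \<Gamma> k x) i = x i k * (1 + rate k x i)"
    using phase_peak[of i k x] assms by (simp add: phase_allowed)
  moreover have "x i k * 1 \<le> x i k * (1 + rate k x i)"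
    using assms rate_bounds(1)[OF assms(1,2), of x] by (intro mult_left_mono) auto
  moreover have "\<theta> \<le> x i k" "0 < x i k" using True assms \<theta>_pos by auto
  moreover from calculation have "\<theta> \<le> x i k * (1 + rate k x i)" by linarith
  ultimately have "max \<theta> (peak (phase Z \<Gamma> k x) i) = x i k * (1 + rate k x i)"
    "max \<theta> (peak x i) = x i k" "0 < x i k"
    using True by (simp_all add: max_absorb2 del: max.absorb_iff2)
  then show ?thesis
    using True rate_bounds(1)[OF assms(1,2), of x] unfolding \<Omega>_def
    by (simp add: ln_mult)
next
  case False
  have "peak x i \<le> peak (phase Z \<Gamma> k x) i"
    using phase_peak[of i k x] phase_bounds(1)[of i k x] assms by simp
  then have "ln (max \<theta> (peak x i)) \<le> ln (max \<theta> (peak (phase Z \<Gamma> k x) i))"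
    using \<theta>_pos by (subst ln_le_cancel_iff) (auto simp: less_max_iff_disj)
  then show ?thesis using False by (auto simp: \<Omega>_def)
qed

text \<open>
  Splitting \<open>r\<close> into its indicator part and the rest \<open>R\<close>, the logarithmic growth of \<open>x i k\<close>
  pays for \<open>R\<close>, while the indicator part is charged to the growth of the row maximum; only the
  latter can be afforded for all clients together.
\<close>
lemma phase_cost:
  assumes k: "k < n" and nonneg: "\<And>i. i < m \<Longrightarrow> 0 \<le> x i k"
    and x0: "\<And>i. i \<in> allowed Z k \<Longrightarrow> x0 i k \<le> x i k" and less: "(\<Sum>i<m. x i k) < 1"
  shows "cost Z \<Gamma> (phase Z \<Gamma> k x) \<le> cost Z \<Gamma> x
    + 4 * (\<Sum>i<m. xs i k * R (sm1 x) (sm2 x) i k * (gain k (phase Z \<Gamma> k x) i - gain k x i))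
    + 4 * (\<Sum>i<m. c i * ys i / \<Gamma> * (\<Omega> (phase Z \<Gamma> k x) i - \<Omega> x i))"
proof -
  define x' where "x' = phase Z \<Gamma> k x"
  define \<epsilon> where "\<epsilon> = eps Z \<Gamma> x k"
  have \<epsilon>: "0 < \<epsilon>" unfolding \<epsilon>_def using k by (rule eps_pos)
  have le_sum: "x i k \<le> (\<Sum>i<m. x i k)" if "i < m" for i
    using that nonneg by (intro member_le_sum[of i _ "\<lambda>i. x i k"]) auto
  have d0: "0 \<le> x' i k - x i k" if "i < m" for i
    using phase_bounds(1)[of i k x] that k nonneg by (simp add: x'_def)
  have dle: "x' i k - x i k \<le> x i k * rate k x i" if "i < m" for i
    using phase_bounds(2)[of i k x] that k nonneg by (simp add: x'_def algebra_simps)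
  have d1: "x' i k - x i k \<le> 1" if "i < m" for i
  proof -
    have "x i k * rate k x i \<le> 1 * 1"
      using le_sum[OF that] less nonneg[OF that] rate_bounds[OF that k, of x] by (intro mult_mono) auto
    then show ?thesis using dle[OF that] by simp
  qed
  have "cost Z \<Gamma> x' - cost Z \<Gamma> x \<le> (\<Sum>i<m. 2 * (R (sm1 x) (sm2 x) i k * (x' i k - x i k))
    + c i * (peak x' i - peak x i) / \<Gamma>)"
  proof (rule cost_increment[OF k])
    fix i assume i: "i < m"
    show "p i k * (x' i k - x i k) \<le> Z"
    proof (cases "i \<in> allowed Z k")
      case True
      then have "p i k \<le> Z" using allowedD(2)[OF True] c_nonneg[OF i] a_nonneg[OF i k] by simp
      then have "p i k * (x' i k - x i k) \<le> Z * 1"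
        using d0[OF i] d1[OF i] Z_pos by (intro mult_mono) auto
      then show ?thesis by simp
    next
      case False
      then show ?thesis using Z_pos by (simp add: x'_def phase_other)
    qed
  qed (use d0 d1 in \<open>auto simp: x'_def phase_other\<close>)
  also have "\<dots> \<le> (\<Sum>i<m. 2 * (\<epsilon> * x i k))"
  proof (rule sum_mono)
    fix i assume "i \<in> {..<m}"
    then have i: "i < m" by simp
    have f: "of_bool b * z \<le> 2 * (of_bool b * z)" if "0 \<le> z" for b and z :: real using that by simp
    have "2 * (R (sm1 x) (sm2 x) i k * (x' i k - x i k)) + c i * (peak x' i - peak x i) / \<Gamma>
      = 2 * (R (sm1 x) (sm2 x) i k * (x' i k - x i k))
        + of_bool (x i k = peak x i) * (c i / \<Gamma> * (x' i k - x i k))"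
      using phase_peak[of i k x] i k nonneg by (simp add: x'_def)
    also have "\<dots> \<le> 2 * (r Z \<Gamma> x i k * (x' i k - x i k))"
      unfolding r_eq[OF i k] distrib_right
      using f[of "c i / \<Gamma> * (x' i k - x i k)" "x i k = peak x i"] c_nonneg[OF i] \<Gamma>_pos d0[OF i]
      by (simp add: mult_ac)
    also have "\<dots> \<le> 2 * (r Z \<Gamma> x i k * (x i k * rate k x i))"
      using dle[OF i] r_pos[OF i k, of x] by (intro mult_left_mono) auto
    also have "\<dots> = 2 * (\<epsilon> * x i k)" using r_pos[OF i k, of x] by (simp add: \<epsilon>_def)
    finally show "2 * (R (sm1 x) (sm2 x) i k * (x' i k - x i k)) + c i * (peak x' i - peak x i) / \<Gamma>
      \<le> 2 * (\<epsilon> * x i k)" .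
  qed
  \<comment> \<open>The comparison enters here: the unfinished entries sum to less than 1 and those
    of \<open>xs\<close> to at least 1.\<close>
  also have "\<dots> = 2 * \<epsilon> * (\<Sum>i<m. x i k)" by (simp add: sum_distrib_left mult_ac)
  also have "\<dots> \<le> 2 * \<epsilon> * (\<Sum>i<m. xs i k)"
    using less feasD(1)[OF k] \<epsilon> by (intro mult_left_mono) auto
  also have "\<dots> = (\<Sum>i<m. 2 * (xs i k * \<epsilon>))" by (simp add: sum_distrib_left mult_ac)
  also have "\<dots> \<le> (\<Sum>i<m. 4 * (xs i k * R (sm1 x) (sm2 x) i k * (gain k x' i - gain k x i))
      + 4 * (c i * ys i / \<Gamma> * (\<Omega> x' i - \<Omega> x i)))"
  proof (rule sum_mono)
    fix i assume "i \<in> {..<m}"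
    then have i: "i < m" by simp
    define L where "L = ln (1 + rate k x i)"
    have L: "0 \<le> L" "rate k x i \<le> 2 * L"
      unfolding L_def using rate_bounds[OF i k, of x] le_two_ln_one_plus[of "rate k x i"] by auto
    have "\<theta> \<le> x i k" if "i \<in> allowed Z k" using x0[OF that] \<theta>_le_x0[OF i k] by simp
    then have \<Omega>: "of_bool (i \<in> allowed Z k \<and> x i k = peak x i) * L \<le> \<Omega> x' i - \<Omega> x i"
      using \<Omega>_step[of i k x] i k nonneg by (simp add: x'_def L_def)
    moreover have "0 \<le> of_bool (i \<in> allowed Z k \<and> x i k = peak x i) * L" using L by simp
    ultimately have \<Omega>0: "0 \<le> \<Omega> x' i - \<Omega> x i" by linarith
    have cy: "0 \<le> c i * ys i / \<Gamma>" using c_nonneg[OF i] feasD(7)[OF i] \<Gamma>_pos by simp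
    show "2 * (xs i k * \<epsilon>) \<le> 4 * (xs i k * R (sm1 x) (sm2 x) i k * (gain k x' i - gain k x i))
      + 4 * (c i * ys i / \<Gamma> * (\<Omega> x' i - \<Omega> x i))"
    proof (cases "i \<in> allowed Z k")
      case True
      have R0: "0 \<le> R (sm1 x) (sm2 x) i k"
        using R_ge[OF i k, of "sm1 x" "sm2 x"] sm1_pos[of x i] sm2_pos[of x i k] Z_pos \<Gamma>_pos
        by (smt (verit) divide_pos_pos mult_pos_pos)
      have "0 < x i k" using x0[OF True] x0_pos[OF i k] by simp
      then have g: "L \<le> gain k x' i - gain k x i"
        using gain_step[of i k x] True k by (simp add: x'_def L_def)
      have "\<epsilon> = r Z \<Gamma> x i k * rate k x i" using r_pos[OF i k, of x] by (simp add: \<epsilon>_def)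
      also have "\<dots> \<le> r Z \<Gamma> x i k * (2 * L)"
        using L r_pos[OF i k, of x] by (intro mult_left_mono) auto
      finally have "xs i k * \<epsilon> \<le> xs i k * (r Z \<Gamma> x i k * (2 * L))"
        using feasD(6)[OF i k] by (intro mult_left_mono) auto
      also have "\<dots> = 2 * (xs i k * R (sm1 x) (sm2 x) i k * L)
          + 2 * (xs i k * (c i / \<Gamma> * (of_bool (x i k = peak x i) * L)))"
        unfolding r_eq[OF i k] by (simp add: algebra_simps)
      \<comment> \<open>Passing from \<open>xs i k\<close> to \<open>ys i\<close> makes the
        coefficient independent of the client, so that the growth of \<open>\<Omega>\<close>
        telescopes over the whole run.\<close>
      also have "xs i k * (c i / \<Gamma> * (of_bool (x i k = peak x i) * L))
          \<le> ys i * (c i / \<Gamma> * (\<Omega> x' i - \<Omega> x i))"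
        using \<Omega> True feasD(2,6)[OF i k] c_nonneg[OF i] \<Gamma>_pos L feasD(7)[OF i]
        by (intro mult_mono mult_left_mono mult_nonneg_nonneg) auto
      also have "xs i k * R (sm1 x) (sm2 x) i k * L
          \<le> xs i k * R (sm1 x) (sm2 x) i k * (gain k x' i - gain k x i)"
        using g R0 feasD(6)[OF i k] by (intro mult_left_mono) auto
      finally have "xs i k * \<epsilon> \<le> 2 * (xs i k * R (sm1 x) (sm2 x) i k * (gain k x' i - gain k x i))
          + 2 * (ys i * (c i / \<Gamma> * (\<Omega> x' i - \<Omega> x i)))" by simp
      moreover have "ys i * (c i / \<Gamma> * (\<Omega> x' i - \<Omega> x i)) = c i * ys i / \<Gamma> * (\<Omega> x' i - \<Omega> x i)"
        by simp
      ultimately show ?thesis by linarith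
    next
      case False
      have "0 \<le> c i * ys i / \<Gamma> * (\<Omega> x' i - \<Omega> x i)" using cy \<Omega>0 by (rule mult_nonneg_nonneg)
      then show ?thesis using feasD(8)[OF i k False] by simp
    qed
  qed
  finally show ?thesis unfolding x'_def sum.distrib sum_distrib_left by linarith
qed

section \<open>Invariants between and during services\<close>

definition charge :: "(nat \<Rightarrow> real) \<Rightarrow> matrix \<Rightarrow> nat \<Rightarrow> real" where
  "charge P Q j = (\<Sum>i<m. xs i j * R P Q i j)"

text \<open>The first term is the cost of the zero matrix. \<open>k\<close> counts arrivals and
  \<open>l\<close> finished clients; they differ by one during a service. The coefficient
  \<open>8 * Lg\<close> is the 4 of \<open>phase_cost\<close> times \<open>2 * Lg\<close>, the
  largest possible gain.\<close>

definition spent :: "nat \<Rightarrow> nat \<Rightarrow> (nat \<Rightarrow> real) \<Rightarrow> matrix \<Rightarrow> matrix \<Rightarrow> real" where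
  "spent k l P Q x = Z * (ln (real m) + ln (real m * real n)) + real k * (5 * Z / (real n * \<Gamma>))
    + 8 * Lg * (\<Sum>j<l. charge P Q j) + 4 * (\<Sum>i<m. c i * ys i / \<Gamma> * \<Omega> x i)"

text \<open>The bound \<open>\<mu>\<close> is due to the last phase of a client: its entries are at
  most 1 beforehand and grow by a factor of at most \<open>\<mu>\<close>.\<close>

definition shape :: "nat \<Rightarrow> matrix \<Rightarrow> bool" where
  "shape k x \<longleftrightarrow> (\<forall>i<m. \<forall>j<n. 0 \<le> x i j \<and> x i j \<le> \<mu> \<and> (i \<notin> allowed Z j \<or> k \<le> j \<longrightarrow> x i j = 0))"

definition served :: "nat \<Rightarrow> matrix \<Rightarrow> bool" where
  "served k x \<longleftrightarrow> shape k x \<and> (\<forall>j<k. 1 \<le> (\<Sum>i<m. x i j)) \<and>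
    (\<exists>P Q. tracks P Q x \<and> cost Z \<Gamma> x \<le> spent k k P Q x)"

text \<open>During the service of \<open>k\<close> the running maxima can still rise. The phases so
  far are therefore accounted for by the gain reached, priced at the current maxima, in place of a
  full \<open>charge\<close>.\<close>

definition serving :: "nat \<Rightarrow> matrix \<Rightarrow> bool" where
  "serving k x \<longleftrightarrow> shape (Suc k) x \<and> (\<forall>j<k. 1 \<le> (\<Sum>i<m. x i j)) \<and>
    (\<forall>i\<in>allowed Z k. x0 i k \<le> x i k) \<and>
    (\<exists>P Q. tracks P Q x \<and>
      cost Z \<Gamma> x \<le> spent (Suc k) k P Q x + 4 * (\<Sum>i<m. xs i k * R P Q i k * gain k x i))"

lemma shapeD:
  assumes "shape k x" "i < m" "j < n"
  shows "0 \<le> x i j" "x i j \<le> \<mu>" "i \<notin> allowed Z j \<Longrightarrow> x i j = 0" "k \<le> j \<Longrightarrow> x i j = 0"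
  using assms unfolding shape_def by auto

lemma R_nonneg: assumes "tracks P Q x" "i < m" "j < n" shows "0 \<le> R P Q i j"
proof -
  have "0 \<le> Z * Q i j / \<Gamma>" using tracks_nonneg(2)[OF assms] Z_pos \<Gamma>_pos by simp
  also have "\<dots> \<le> R P Q i j" using tracks_nonneg[OF assms(1,2)] assms by (intro R_ge) auto
  finally show ?thesis .
qed

lemma charge_nonneg: assumes "tracks P Q x" "j < n" shows "0 \<le> charge P Q j"
  unfolding charge_def using R_nonneg[OF assms(1)] feasD(6) assms(2) by (intro sum_nonneg) auto

lemma charge_mono:
  assumes "\<And>i. P i \<le> P' i" "\<And>i j. Q i j \<le> Q' i j" "j < n"
  shows "charge P Q j \<le> charge P' Q' j"
  unfolding charge_def using assms feasD(6) by (intro sum_mono mult_left_mono R_mono) auto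

lemma served_0: "served 0 (\<lambda>_ _. 0)"
proof -
  have "peak (\<lambda>_ _. 0) i = 0" for i using index_ne by simp
  moreover have "\<Omega> (\<lambda>_ _. 0) i = 0" for i
    using index_ne \<theta>_pos by (simp add: \<Omega>_def max_absorb1)
  ultimately have "cost Z \<Gamma> (\<lambda>_ _. 0) \<le> spent 0 0 P Q (\<lambda>_ _. 0)" for P Q
    using m_ge_2 n_ge_2 unfolding cost_eq spent_def \<Phi>_eq by (simp add: v_til_def)
  then show ?thesis unfolding served_def using tracks_0 \<mu>_gt_1 by (auto simp: shape_def)
qed

lemma gain_nonneg:
  assumes "serving k x" "k < n" "i \<in> allowed Z k" shows "0 \<le> gain k x i"
proof -
  have "ln (x0 i k) \<le> ln (x i k)"
    using assms x0_pos[OF allowedD(1)[OF assms(3)] assms(2)]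
    by (subst ln_le_cancel_iff) (force simp: serving_def)+
  moreover have "0 \<le> (if x i k = peak x i then ln \<mu> else 0)" using \<mu>_gt_1 by simp
  ultimately show ?thesis unfolding gain_def by linarith
qed

text \<open>\<open>ln \<mu>\<close> can occur twice, from the entry and from the bonus for attaining
  the row maximum. As \<open>ln \<theta> \<le> 0\<close>, doubling
  \<open>ln \<mu> - ln \<theta>\<close> covers both.\<close>

lemma gain_le:
  assumes "serving k x" "k < n" "i \<in> allowed Z k" shows "gain k x i \<le> 2 * Lg"
proof -
  note i = allowedD(1)[OF assms(3)]
  have x: "x i k \<le> \<mu>" "0 < x i k"
    using assms shapeD(2)[of "Suc k" x i k] i x0_pos[OF i assms(2)] by (force simp: serving_def)+
  then have "ln (x i k) \<le> ln \<mu>" by (subst ln_le_cancel_iff) auto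
  moreover have "ln \<theta> \<le> ln (x0 i k)"
    using \<theta>_pos \<theta>_le_x0[OF i assms(2)] by (subst ln_le_cancel_iff) auto
  moreover have "ln \<theta> \<le> 0" using \<theta>_pos \<theta>_le_1 by simp
  moreover have "(if x i k = peak x i then ln \<mu> else 0) \<le> ln \<mu>" using \<mu>_gt_1 by simp
  ultimately show ?thesis unfolding gain_def ln_\<theta>[symmetric] by argo
qed

lemma \<Omega>_le: assumes "shape k x" "i < m" shows "\<Omega> x i \<le> Lg"
proof -
  have "peak x i \<le> \<mu>" using shapeD(2)[OF assms] index_ne by (subst Max_le_iff) auto
  then have "ln (max \<theta> (peak x i)) \<le> ln \<mu>"
    using \<theta>_pos \<theta>_le_1 \<mu>_gt_1 by (subst ln_le_cancel_iff) (auto simp: less_max_iff_disj)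
  then show ?thesis unfolding \<Omega>_def ln_\<theta>[symmetric] by simp
qed

section \<open>Preservation of the invariants\<close>

lemma arrive_serving:
  assumes s: "served k x" and k: "k < n"
  shows "serving k (arrive Z k x)"
proof -
  define x' where "x' = arrive Z k x"
  obtain P Q where t: "tracks P Q x" and cost: "cost Z \<Gamma> x \<le> spent k k P Q x"
    using s unfolding served_def by auto
  have sh: "shape k x" using s unfolding served_def by simp
  have x0k: "x i k = 0" if "i < m" for i using shapeD(4)[OF sh that k] by simp
  have x': "x' i j = (if j = k \<and> i \<in> allowed Z k then x0 i k else x i j)" for i j
    unfolding x'_def arrive_def by auto
  have x0: "0 < x0 i k" "x0 i k \<le> 1 / (2 * real m * real n)" "x0 i k \<le> 1" if "i < m" for i
  proof -
    show "0 < x0 i k" "x0 i k \<le> 1 / (2 * real m * real n)" using x0_pos x0_le that k by auto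
    moreover have "1 / (2 * real m * real n) \<le> 1" using mn_ge_4 by (simp add: field_simps)
    ultimately show "x0 i k \<le> 1" by linarith
  qed
  have le: "x i j \<le> x' i j" if "i < m" "j < n" for i j
    using x0(1)[OF that(1)] x0k[OF that(1)] by (auto simp: x')
  obtain P' Q' where t': "tracks P' Q' x'" and PQ: "\<And>i. P i \<le> P' i" "\<And>i j. Q i j \<le> Q' i j"
    using tracks_mono[OF t le] by metis
  \<comment> \<open>On an allowed facility each of \<open>Z\<close>, \<open>p i k\<close>,
    \<open>a i k\<close>, \<open>c i\<close> and \<open>c i * p i k / Z\<close> is at most
    \<open>Z\<close>, and the initial fraction is at most \<open>1 / (2 * m * n)\<close>;
    \<open>B\<close> bounds each of these products.\<close>
  define B where "B = Z / (2 * real m * real n)"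
  have B: "0 \<le> B" unfolding B_def using Z_pos by simp
  have part: "0 \<le> x' i k \<and> Z * x' i k \<le> B \<and> p i k * x' i k \<le> B \<and> a i k * x' i k \<le> B
      \<and> c i * x' i k \<le> B \<and> c i * p i k / Z * x' i k \<le> B \<and> p i k * x' i k \<le> Z" if i: "i < m" for i
  proof (cases "i \<in> allowed Z k")
    case True
    have tot: "total i k \<le> Z" using allowedD(2)[OF True] .
    note nn = p_nonneg[OF i k] a_nonneg[OF i k] c_nonneg[OF i]
    have small: "z * x0 i k \<le> B" if "z \<le> Z" "0 \<le> z" for z
    proof -
      have "z * x0 i k \<le> Z * (1 / (2 * real m * real n))"
        using that x0[OF i] Z_pos by (intro mult_mono) auto
      then show ?thesis by (simp add: B_def)
    qed
    have "c i * p i k \<le> Z * Z" using tot nn by (intro mult_mono) auto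
    then have "c i * p i k / Z \<le> Z" using Z_pos by (simp add: divide_le_eq)
    moreover have "B \<le> Z"
      unfolding B_def using mn_ge_4 Z_pos by (simp add: divide_le_eq)
    ultimately show ?thesis
      using small[of Z] small[of "p i k"] small[of "a i k"] small[of "c i"]
        small[of "c i * p i k / Z"] tot nn Z_pos True x0(1)[OF i]
      by (auto simp: x')
  next
    case False
    then show ?thesis using B x0k[OF i] Z_pos by (auto simp: x')
  qed
  have "cost Z \<Gamma> x' - cost Z \<Gamma> x \<le> (\<Sum>i<m. 2 * (R (sm1 x) (sm2 x) i k * (x' i k - x i k))
    + c i * (peak x' i - peak x i) / \<Gamma>)"
    using part x0k x0 by (intro cost_increment[OF k]) (auto simp: x')
  \<comment> \<open>\<open>R\<close> has four terms, each worth at most \<open>B / \<Gamma>\<close>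
    and counted twice; the row maximum adds one more.\<close>
  also have "\<dots> \<le> (\<Sum>i<m. 9 * B / \<Gamma>)"
  proof (rule sum_mono)
    fix i assume "i \<in> {..<m}"
    then have i: "i < m" by simp
    note part = part[OF i]
    have "R (sm1 x) (sm2 x) i k * x' i k
      = (sm1 x i * (p i k * x' i k) + sm2 x i k * (Z * x' i k) + c i * p i k / Z * x' i k
         + a i k * x' i k) / \<Gamma>"
      unfolding R_def by (simp add: algebra_simps)
    also have "\<dots> \<le> (1 * B + 1 * B + B + B) / \<Gamma>"
      using part sm1_le_1[OF i, of x] sm2_le_1[OF i k, of x] sm1_pos[of x i] sm2_pos[of x i k] \<Gamma>_pos
        p_nonneg[OF i k] Z_pos
      by (intro divide_right_mono add_mono mult_mono) auto
    finally have 1: "R (sm1 x) (sm2 x) i k * x' i k \<le> 4 * B / \<Gamma>" by simp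
    have "peak x' i = max (peak x i) (x' i k)"
      using le[OF i k] k by (intro peak_update) (auto simp: x')
    moreover have "0 \<le> peak x i" using peak_ge[OF k, of x i] x0k[OF i] by linarith
    ultimately have "peak x' i - peak x i \<le> x' i k" using part by auto
    then have "c i * (peak x' i - peak x i) \<le> c i * x' i k"
      using c_nonneg[OF i] by (rule mult_left_mono)
    also have "\<dots> \<le> B" using part by simp
    finally have 2: "c i * (peak x' i - peak x i) / \<Gamma> \<le> B / \<Gamma>"
      using \<Gamma>_pos by (intro divide_right_mono) auto
    have "9 * B / \<Gamma> = 2 * (4 * B / \<Gamma>) + B / \<Gamma>" by simp
    then show "2 * (R (sm1 x) (sm2 x) i k * (x' i k - x i k)) + c i * (peak x' i - peak x i) / \<Gamma>
        \<le> 9 * B / \<Gamma>"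
      unfolding x0k[OF i] diff_zero using 1 2 by linarith
  qed
  also have "\<dots> = 9 / 2 * (Z / (real n * \<Gamma>))" unfolding B_def using m_ge_2 by simp
  also have "\<dots> \<le> 5 * (Z / (real n * \<Gamma>))" using Z_pos \<Gamma>_pos by (intro mult_right_mono) auto
  finally have inc: "cost Z \<Gamma> x' \<le> cost Z \<Gamma> x + 5 * Z / (real n * \<Gamma>)" by simp
  have sh': "shape (Suc k) x'"
    unfolding shape_def using shapeD[OF sh] x0 \<mu>_gt_1 by (force simp: x')
  have "(\<Sum>j<k. charge P Q j) \<le> (\<Sum>j<k. charge P' Q' j)"
    using PQ k by (intro sum_mono charge_mono) auto
  then have ch: "8 * Lg * (\<Sum>j<k. charge P Q j) \<le> 8 * Lg * (\<Sum>j<k. charge P' Q' j)"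
    using Lg_ge_1 by (intro mult_left_mono) auto
  have "\<Omega> x i \<le> \<Omega> x' i" if i: "i < m" for i
  proof -
    have "peak x i \<le> peak x' i"
      using le[OF i k] k by (subst (2) peak_update[of k]) (auto simp: x')
    then show ?thesis unfolding \<Omega>_def using \<theta>_pos
      by (auto simp: less_max_iff_disj intro!: ln_mono)
  qed
  then have om: "(\<Sum>i<m. c i * ys i / \<Gamma> * \<Omega> x i) \<le> (\<Sum>i<m. c i * ys i / \<Gamma> * \<Omega> x' i)"
    using c_nonneg feasD(7) \<Gamma>_pos by (intro sum_mono mult_left_mono) auto
  have "spent (Suc k) k P' Q' x' - spent k k P Q x = 5 * Z / (real n * \<Gamma>)
      + (8 * Lg * (\<Sum>j<k. charge P' Q' j) - 8 * Lg * (\<Sum>j<k. charge P Q j))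
      + 4 * ((\<Sum>i<m. c i * ys i / \<Gamma> * \<Omega> x' i) - (\<Sum>i<m. c i * ys i / \<Gamma> * \<Omega> x i))"
    unfolding spent_def by (simp add: distrib_right add_divide_distrib)
  then have "cost Z \<Gamma> x' \<le> spent (Suc k) k P' Q' x'" using cost inc ch om by argo
  moreover have g0: "0 \<le> (\<Sum>i<m. xs i k * R P' Q' i k * gain k x' i)"
  proof (rule sum_nonneg)
    fix i assume "i \<in> {..<m}"
    then have i: "i < m" by simp
    show "0 \<le> xs i k * R P' Q' i k * gain k x' i"
    proof (cases "i \<in> allowed Z k")
      case True
      then have "0 \<le> gain k x' i" unfolding gain_def using \<mu>_gt_1 by (simp add: x')
      then show ?thesis using feasD(6)[OF i k] R_nonneg[OF t' i k] by simp
    qed (use feasD(8)[OF i k] in simp)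
  qed
  ultimately have "cost Z \<Gamma> x' \<le> spent (Suc k) k P' Q' x'
      + 4 * (\<Sum>i<m. xs i k * R P' Q' i k * gain k x' i)" by linarith
  moreover have "1 \<le> (\<Sum>i<m. x' i j)" if "j < k" for j
    using s that unfolding served_def by (simp add: x')
  ultimately show ?thesis
    unfolding serving_def x'_def[symmetric] using sh' t' by (auto simp: x')
qed

lemma phase_serving:
  assumes s: "serving k x" and k: "k < n" and less: "(\<Sum>i<m. x i k) < 1"
  shows "serving k (phase Z \<Gamma> k x)"
proof -
  define x' where "x' = phase Z \<Gamma> k x"
  obtain P Q where t: "tracks P Q x" and
    cost: "cost Z \<Gamma> x \<le> spent (Suc k) k P Q x + 4 * (\<Sum>i<m. xs i k * R P Q i k * gain k x i)"
    using s unfolding serving_def by auto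
  have sh: "shape (Suc k) x" using s unfolding serving_def by simp
  have x0: "x0 i k \<le> x i k" if "i \<in> allowed Z k" for i using s that unfolding serving_def by simp
  have nonneg: "0 \<le> x i k" if "i < m" for i using shapeD(1)[OF sh that k] .
  have lek: "x i k \<le> x' i k" if "i < m" for i
    unfolding x'_def using that k nonneg by (intro phase_bounds) auto
  have x': "x' i j = x i j" if "j \<noteq> k \<or> i \<notin> allowed Z j" for i j
    using that unfolding x'_def by (cases "j = k") (auto simp: phase_other)
  have le: "x i j \<le> x' i j" if "i < m" "j < n" for i j
    using lek[OF that(1)] x'[of j i] by (cases "j = k") auto
  have ub: "x' i k \<le> \<mu>" if i: "i < m" for i
  proof -
    have "x i k \<le> (\<Sum>i<m. x i k)"
      using i nonneg by (intro member_le_sum[of i _ "\<lambda>i. x i k"]) auto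
    then have "x i k * (1 + rate k x i) \<le> 1 * \<mu>"
      using rate_bounds[OF i k, of x] less nonneg[OF i] by (intro mult_mono) auto
    then show ?thesis using phase_bounds(2)[OF i k, of x] nonneg[OF i] by (simp add: x'_def)
  qed
  obtain P' Q' where t': "tracks P' Q' x'" and PQ: "\<And>i. P i \<le> P' i" "\<And>i j. Q i j \<le> Q' i j"
    using tracks_mono[OF t le] by metis
  have sh': "shape (Suc k) x'"
    unfolding shape_def
  proof (intro allI impI conjI)
    fix i j assume ij: "i < m" "j < n"
    show "0 \<le> x' i j" using shapeD(1)[OF sh ij] le[OF ij] by simp
    show "x' i j \<le> \<mu>" using shapeD(2)[OF sh ij] ub[OF ij(1)] x'[of j i] by (cases "j = k") auto
    show "x' i j = 0" if "i \<notin> allowed Z j \<or> Suc k \<le> j"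
    proof -
      have "x' i j = x i j" using that by (intro x') auto
      then show ?thesis using that shapeD(3,4)[OF sh ij] by auto
    qed
  qed
  have sums: "1 \<le> (\<Sum>i<m. x' i j)" if "j < k" for j
    using s that unfolding serving_def by (simp add: x')
  have x0': "x0 i k \<le> x' i k" if "i \<in> allowed Z k" for i
    using x0[OF that] lek[OF allowedD(1)[OF that]] by simp
  have ch: "8 * Lg * (\<Sum>j<k. charge P Q j) \<le> 8 * Lg * (\<Sum>j<k. charge P' Q' j)"
    using PQ k Lg_ge_1 by (intro mult_left_mono sum_mono charge_mono) auto
  \<comment> \<open>The old gain is repriced at the new maxima and the fresh gain, priced at current
    weights, is raised to them too. Both are allowed because gains are nonnegative and do not
    fall.\<close>
  have old: "(\<Sum>i<m. xs i k * R P Q i k * gain k x i)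
      + (\<Sum>i<m. xs i k * R (sm1 x) (sm2 x) i k * (gain k x' i - gain k x i))
      \<le> (\<Sum>i<m. xs i k * R P' Q' i k * gain k x' i)"
    unfolding sum.distrib[symmetric]
  proof (rule sum_mono)
    fix i assume "i \<in> {..<m}"
    then have i: "i < m" by simp
    show "xs i k * R P Q i k * gain k x i + xs i k * R (sm1 x) (sm2 x) i k * (gain k x' i - gain k x i)
      \<le> xs i k * R P' Q' i k * gain k x' i"
    proof (cases "i \<in> allowed Z k")
      case True
      have g: "0 \<le> gain k x i" using gain_nonneg[OF s k True] .
      have "0 < x i k" using x0[OF True] x0_pos[OF i k] by simp
      then have "gain k x i + ln (1 + rate k x i) \<le> gain k x' i"
        unfolding x'_def using True k by (intro gain_step) auto
      then have g': "0 \<le> gain k x' i - gain k x i"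
        using rate_bounds(1)[OF i k, of x] by (smt (verit) ln_ge_zero)
      have R1: "R P Q i k \<le> R P' Q' i k" using PQ by (intro R_mono i k)
      have "R (sm1 x) (sm2 x) i k \<le> R P Q i k"
        using t i k by (intro R_mono) (auto simp: tracks_def)
      then have R2: "R (sm1 x) (sm2 x) i k \<le> R P' Q' i k" using R1 by simp
      have "R P Q i k * gain k x i + R (sm1 x) (sm2 x) i k * (gain k x' i - gain k x i)
        \<le> R P' Q' i k * gain k x i + R P' Q' i k * (gain k x' i - gain k x i)"
        using R1 R2 g g' by (intro add_mono mult_right_mono)
      then have "xs i k * (R P Q i k * gain k x i + R (sm1 x) (sm2 x) i k * (gain k x' i - gain k x i))
        \<le> xs i k * (R P' Q' i k * gain k x' i)"
        using feasD(6)[OF i k] by (intro mult_left_mono) (auto simp: algebra_simps)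
      then show ?thesis by (simp add: algebra_simps)
    qed (use feasD(8)[OF i k] in simp)
  qed
  have "cost Z \<Gamma> x' \<le> cost Z \<Gamma> x
    + 4 * (\<Sum>i<m. xs i k * R (sm1 x) (sm2 x) i k * (gain k x' i - gain k x i))
    + 4 * (\<Sum>i<m. c i * ys i / \<Gamma> * (\<Omega> x' i - \<Omega> x i))"
    unfolding x'_def using k nonneg x0 less by (rule phase_cost)
  moreover have "(\<Sum>i<m. c i * ys i / \<Gamma> * (\<Omega> x' i - \<Omega> x i))
    = (\<Sum>i<m. c i * ys i / \<Gamma> * \<Omega> x' i) - (\<Sum>i<m. c i * ys i / \<Gamma> * \<Omega> x i)"
    by (simp only: right_diff_distrib sum_subtractf)
  moreover have "spent (Suc k) k P' Q' x' - spent (Suc k) k P Q x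
      = (8 * Lg * (\<Sum>j<k. charge P' Q' j) - 8 * Lg * (\<Sum>j<k. charge P Q j))
      + 4 * ((\<Sum>i<m. c i * ys i / \<Gamma> * \<Omega> x' i) - (\<Sum>i<m. c i * ys i / \<Gamma> * \<Omega> x i))"
    unfolding spent_def by simp
  ultimately have "cost Z \<Gamma> x' \<le> spent (Suc k) k P' Q' x'
      + 4 * (\<Sum>i<m. xs i k * R P' Q' i k * gain k x' i)"
    using cost ch old by argo
  then show ?thesis
    unfolding serving_def x'_def[symmetric] using sh' t' sums x0' by auto
qed

text \<open>Bounding each gain by \<open>2 * Lg\<close> completes the charge of client
  \<open>k\<close>. This is valid after every phase, not only the last, and so also controls the
  failure test.\<close>

lemma serving_spent:
  assumes s: "serving k x" and k: "k < n"
  obtains P Q where "tracks P Q x" "cost Z \<Gamma> x \<le> spent (Suc k) (Suc k) P Q x"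
proof -
  obtain P Q where t: "tracks P Q x" and
    cost: "cost Z \<Gamma> x \<le> spent (Suc k) k P Q x + 4 * (\<Sum>i<m. xs i k * R P Q i k * gain k x i)"
    using s unfolding serving_def by auto
  have "(\<Sum>i<m. xs i k * R P Q i k * gain k x i) \<le> (\<Sum>i<m. xs i k * R P Q i k * (2 * Lg))"
  proof (rule sum_mono)
    fix i assume "i \<in> {..<m}"
    then have i: "i < m" by simp
    show "xs i k * R P Q i k * gain k x i \<le> xs i k * R P Q i k * (2 * Lg)"
    proof (cases "i \<in> allowed Z k")
      case True
      then show ?thesis using gain_le[OF s k True] feasD(6)[OF i k] R_nonneg[OF t i k]
        by (intro mult_left_mono) auto
    qed (use feasD(8)[OF i k] in simp)
  qed
  also have "\<dots> = 2 * Lg * charge P Q k" unfolding charge_def sum_distrib_left by (simp add: mult_ac)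
  finally have "cost Z \<Gamma> x \<le> spent (Suc k) (Suc k) P Q x"
    using cost unfolding spent_def sum.lessThan_Suc distrib_left by linarith
  with t show thesis by (rule that)
qed

lemma serving_served:
  assumes "serving k x" "k < n" "1 \<le> (\<Sum>i<m. x i k)" shows "served (Suc k) x"
proof -
  obtain P Q where "tracks P Q x" "cost Z \<Gamma> x \<le> spent (Suc k) (Suc k) P Q x"
    using serving_spent[OF assms(1,2)] .
  then show ?thesis using assms unfolding serving_def served_def by (auto simp: less_Suc_eq)
qed

section \<open>Excluding failure\<close>

text \<open>Here the constraints of LP1 act on \<open>xs\<close>: the load is at most
  \<open>Z * ys i\<close>, hence at most \<open>Z * ls\<close>, which handles the terms with
  \<open>P\<close> and with \<open>c\<close>; entries are at most \<open>ls\<close>, which handles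
  \<open>Q\<close>.\<close>

lemma sum_charge_le:
  assumes t: "tracks P Q x"
  shows "\<Gamma> * (\<Sum>j<n. charge P Q j) \<le> Z * ls * ((\<Sum>i<m. P i) + (\<Sum>i<m. \<Sum>j<n. Q i j))
    + (\<Sum>i<m. c i * ys i) + (\<Sum>i<m. \<Sum>j<n. a i j * xs i j)"
proof -
  have "\<Gamma> * (\<Sum>j<n. charge P Q j) = (\<Sum>i<m. \<Sum>j<n. \<Gamma> * (xs i j * R P Q i j))"
    unfolding charge_def by (subst sum.swap) (simp add: sum_distrib_left)
  also have "\<dots> = (\<Sum>i<m. \<Sum>j<n. P i * (p i j * xs i j) + Z * (Q i j * xs i j)
      + c i / Z * (p i j * xs i j) + a i j * xs i j)"
  proof (intro sum.cong refl)
    fix i j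
    have "\<Gamma> * (xs i j * R P Q i j) = xs i j * (p i j * P i + Z * Q i j + c i * p i j / Z + a i j)"
      unfolding R_def using \<Gamma>_pos by simp
    then show "\<Gamma> * (xs i j * R P Q i j) = P i * (p i j * xs i j) + Z * (Q i j * xs i j)
      + c i / Z * (p i j * xs i j) + a i j * xs i j"
      by (simp add: algebra_simps)
  qed
  also have "\<dots> = (\<Sum>i<m. P i * (\<Sum>j<n. p i j * xs i j) + Z * (\<Sum>j<n. Q i j * xs i j)
      + c i / Z * (\<Sum>j<n. p i j * xs i j) + (\<Sum>j<n. a i j * xs i j))"
    by (simp add: sum.distrib sum_distrib_left)
  also have "\<dots> \<le> (\<Sum>i<m. Z * ls * P i + Z * ls * (\<Sum>j<n. Q i j) + c i * ys i
      + (\<Sum>j<n. a i j * xs i j))"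
  proof (rule sum_mono)
    fix i assume "i \<in> {..<m}"
    then have i: "i < m" by simp
    have "Z * ys i \<le> Z * ls" using feasD(4)[OF i] Z_pos by simp
    then have "P i * (\<Sum>j<n. p i j * xs i j) \<le> P i * (Z * ls)"
      using feasD(3)[OF i] tracks_nonneg(1)[OF t i] by (intro mult_left_mono) auto
    moreover have "(\<Sum>j<n. Q i j * xs i j) \<le> (\<Sum>j<n. Q i j * ls)"
      using tracks_nonneg(2)[OF t i] feasD(2)[OF i] feasD(4)[OF i]
      by (intro sum_mono mult_left_mono) (auto intro: order_trans)
    then have "Z * (\<Sum>j<n. Q i j * xs i j) \<le> Z * (\<Sum>j<n. Q i j * ls)"
      using Z_pos by (intro mult_left_mono) auto
    moreover have "c i / Z * (\<Sum>j<n. p i j * xs i j) \<le> c i / Z * (Z * ys i)"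
      using feasD(3)[OF i] c_nonneg[OF i] Z_pos by (intro mult_left_mono) auto
    moreover have "Z * (\<Sum>j<n. Q i j * ls) = Z * ls * (\<Sum>j<n. Q i j)"
      by (simp add: sum_distrib_left mult_ac)
    moreover have "P i * (Z * ls) = Z * ls * P i" "c i / Z * (Z * ys i) = c i * ys i"
      using Z_pos by simp_all
    ultimately show "P i * (\<Sum>j<n. p i j * xs i j) + Z * (\<Sum>j<n. Q i j * xs i j)
      + c i / Z * (\<Sum>j<n. p i j * xs i j) + (\<Sum>j<n. a i j * xs i j)
      \<le> Z * ls * P i + Z * ls * (\<Sum>j<n. Q i j) + c i * ys i + (\<Sum>j<n. a i j * xs i j)"
      by linarith
  qed
  also have "\<dots> = Z * ls * ((\<Sum>i<m. P i) + (\<Sum>i<m. \<Sum>j<n. Q i j))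
    + (\<Sum>i<m. c i * ys i) + (\<Sum>i<m. \<Sum>j<n. a i j * xs i j)"
    by (simp add: sum.distrib sum_distrib_left distrib_left)
  finally show ?thesis .
qed

lemma cost_ge_\<Phi>: assumes "shape k x" shows "Z * \<Phi> Z \<Gamma> x \<le> cost Z \<Gamma> x"
proof -
  have "0 \<le> (\<Sum>i<m. c i * v_til Z \<Gamma> x i + c i * peak x i / \<Gamma> + (\<Sum>j<n. a i j * x i j) / \<Gamma>)"
  proof (rule sum_nonneg)
    fix i assume "i \<in> {..<m}"
    then have i: "i < m" by simp
    note x = shapeD(1)[OF assms i]
    have "0 \<le> v_til Z \<Gamma> x i" unfolding v_til_def
      using x p_nonneg[OF i] Z_pos \<Gamma>_pos by (intro divide_nonneg_nonneg sum_nonneg) auto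
    moreover have "0 \<le> peak x i" using order_trans[OF x[of 0] peak_ge[of 0 x i]] n_ge_2 by simp
    moreover have "0 \<le> (\<Sum>j<n. a i j * x i j)" using x a_nonneg[OF i] by (intro sum_nonneg) auto
    ultimately show "0 \<le> c i * v_til Z \<Gamma> x i + c i * peak x i / \<Gamma> + (\<Sum>j<n. a i j * x i j) / \<Gamma>"
      using c_nonneg[OF i] \<Gamma>_pos by simp
  qed
  then show ?thesis unfolding cost_eq by simp
qed

text \<open>
  The bound is self-referential: the charges grow with \<open>\<Phi>\<close>, hence with the cost itself, but
  only with factor \<open>1/2\<close>.
\<close>
lemma cost_le:
  assumes t: "tracks P Q x" and cost: "cost Z \<Gamma> x \<le> spent k k P Q x" and sh: "shape k x" and k: "k \<le> n"
  shows "cost Z \<Gamma> x \<le> 5 * Z * ln (exp 1 * real m * real n)"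
proof -
  define A where "A = ln (real m) + ln (real m * real n)"
  define cy where "cy = (\<Sum>i<m. c i * ys i)"
  define ax where "ax = (\<Sum>i<m. \<Sum>j<n. a i j * xs i j)"
  define V where "V = LP1_cost Z xs ys ls"
  define W where "W = (\<Sum>i<m. P i) + (\<Sum>i<m. \<Sum>j<n. Q i j)"
  define D where "D = cost Z \<Gamma> x - Z * A"
  have V: "V = cy + Z * ls + ax" unfolding V_def cy_def ax_def LP1_cost_def ..
  have cy0: "0 \<le> cy" unfolding cy_def using c_nonneg feasD(7) by (intro sum_nonneg) auto
  have ax0: "0 \<le> ax" unfolding ax_def using a_nonneg feasD(6) by (intro sum_nonneg) auto
  have "(\<Sum>i<m. sm1 x i) = 1"
    unfolding sm1_def sum_divide_distrib[symmetric] using S1_pos[of x] by simp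
  then have P1: "1 \<le> (\<Sum>i<m. P i)"
    using t sum_mono[of "{..<m}" "sm1 x" P] by (simp add: tracks_def)
  have "(\<Sum>i<m. \<Sum>j<n. sm2 x i j) = 1"
    unfolding sm2_def sum_divide_distrib[symmetric] using S2_pos[of x] by simp
  moreover have "(\<Sum>i<m. \<Sum>j<n. sm2 x i j) \<le> (\<Sum>i<m. \<Sum>j<n. Q i j)"
    using t by (intro sum_mono) (auto simp: tracks_def)
  ultimately have W2: "2 \<le> W" using P1 by (simp add: W_def)
  have "W \<le> 2 + \<Phi> Z \<Gamma> x - A" using t by (simp add: W_def A_def tracks_def)
  then have "Z * W \<le> Z * (2 + \<Phi> Z \<Gamma> x - A)" using Z_pos by (intro mult_left_mono) auto
  also have "\<dots> \<le> 2 * Z + D" using cost_ge_\<Phi>[OF sh] by (simp add: D_def algebra_simps)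
  finally have ZW: "Z * W \<le> 2 * Z + D" .
  have "(\<Sum>j<k. charge P Q j) \<le> (\<Sum>j<n. charge P Q j)"
    using k charge_nonneg[OF t] by (intro sum_mono2) auto
  then have ch: "8 * Lg * (\<Sum>j<k. charge P Q j) \<le> 8 * Lg * ((Z * ls * W + cy + ax) / \<Gamma>)"
    using sum_charge_le[OF t] \<Gamma>_pos Lg_ge_1
    by (intro mult_left_mono) (auto simp: W_def cy_def ax_def pos_le_divide_eq mult.commute[of \<Gamma>]
        intro: order_trans[OF mult_right_mono])
  have "(\<Sum>i<m. c i * ys i / \<Gamma> * \<Omega> x i) \<le> (\<Sum>i<m. c i * ys i / \<Gamma> * Lg)"
    using \<Omega>_le[OF sh] c_nonneg feasD(7) \<Gamma>_pos by (intro sum_mono mult_left_mono) auto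
  also have "\<dots> = Lg * (cy / \<Gamma>)"
    unfolding cy_def sum_divide_distrib sum_distrib_left by (simp add: mult_ac)
  finally have "(\<Sum>i<m. c i * ys i / \<Gamma> * \<Omega> x i) \<le> Lg * (cy / \<Gamma>)" .
  moreover have "0 \<le> Lg * (cy / \<Gamma>)" using cy0 \<Gamma>_pos Lg_ge_1 by (intro mult_nonneg_nonneg) auto
  ultimately have om: "4 * (\<Sum>i<m. c i * ys i / \<Gamma> * \<Omega> x i) \<le> 8 * Lg * (cy / \<Gamma>)" by linarith
  \<comment> \<open>The facility cost appears twice, from the charges and from
    \<open>\<Omega>\<close>. As each softmax family sums to 1, \<open>W\<close> is at least 2 and
    absorbs this, leaving the full cost \<open>V\<close> times \<open>W\<close>.\<close>
  have "2 * cy + ax \<le> W * (cy + ax)"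
    using W2 cy0 ax0 mult_right_mono[of 2 W "cy + ax"] by simp
  then have "Z * ls * W + 2 * cy + ax \<le> V * W" unfolding V by (simp add: algebra_simps)
  then have "8 * Lg * ((Z * ls * W + 2 * cy + ax) / \<Gamma>) \<le> 8 * Lg * (V * W / \<Gamma>)"
    using \<Gamma>_pos Lg_ge_1 by (intro mult_left_mono divide_right_mono) auto
  also have "\<dots> = (16 * Lg * V) * W / (2 * \<Gamma>)" by simp
  also have "\<dots> \<le> (Z * \<Gamma>) * W / (2 * \<Gamma>)"
    using budget W2 \<Gamma>_pos unfolding V_def by (intro divide_right_mono mult_right_mono) auto
  also have "\<dots> = Z * W / 2" using \<Gamma>_pos by simp
  finally have main: "8 * Lg * ((Z * ls * W + 2 * cy + ax) / \<Gamma>) \<le> Z * W / 2" .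
  have "real k * (5 * Z / (real n * \<Gamma>)) \<le> real n * (5 * Z / (real n * \<Gamma>))"
    using k Z_pos \<Gamma>_pos by (intro mult_right_mono) auto
  also have "\<dots> = 5 * Z / \<Gamma>" using n_ge_2 by simp
  also have "\<dots> \<le> 5 * Z / 10" using \<Gamma>_ge_16 Z_pos by (intro divide_left_mono) auto
  finally have arr: "real k * (5 * Z / (real n * \<Gamma>)) \<le> Z / 2" by simp
  have "8 * Lg * ((Z * ls * W + cy + ax) / \<Gamma>) + 8 * Lg * (cy / \<Gamma>)
      = 8 * Lg * ((Z * ls * W + 2 * cy + ax) / \<Gamma>)"
    by (simp add: add_divide_distrib distrib_left)
  then have "D \<le> Z / 2 + Z * W / 2"
    using cost ch om main arr unfolding spent_def D_def A_def by linarith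
  \<comment> \<open>Inserting \<open>Z * W \<le> 2 * Z + D\<close> yields
    \<open>D \<le> 3 * Z / 2 + D / 2\<close>.\<close>
  then have "D \<le> 3 * Z" using ZW by linarith
  moreover have "A \<le> 2 * ln (real m * real n)"
    unfolding A_def using m_ge_2 n_ge_2 by (simp add: ln_mult)
  then have "Z * A \<le> Z * (2 * ln (real m * real n))" using Z_pos by (intro mult_left_mono) auto
  moreover have "0 \<le> Z * ln (real m * real n)" using Z_pos ln_mn_ge_1 by simp
  ultimately have "cost Z \<Gamma> x \<le> 5 * Z + 5 * (Z * ln (real m * real n))"
    using Z_pos unfolding D_def by linarith
  then show ?thesis unfolding ln_emn by (simp add: algebra_simps)
qed

section \<open>Termination and the full run\<close>

text \<open>Entries between 0 and \<open>\<mu>\<close> keep the softmax weights away from 0, which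
  bounds every \<open>r\<close> from below; weights of at most 1 bound \<open>r\<close> from above.
  The quotient of the two bounds is uniform over the service.\<close>

lemma rate_lower_bound:
  assumes "i < m" "k < n"
  obtains \<delta> where "0 < \<delta>" "\<And>x. serving k x \<Longrightarrow> \<delta> \<le> ln (1 + rate k x i)"
proof -
  define lo where "lo = Z * (1 / (real m * real n * exp (\<mu> / \<Gamma>))) / \<Gamma>"
  define hi where "hi = R (\<lambda>_. 1) (\<lambda>_ _. 1) i k + c i / \<Gamma>"
  have lo: "0 < lo" unfolding lo_def using Z_pos \<Gamma>_pos m_ge_2 n_ge_2 by simp
  have lo_le: "lo \<le> r Z \<Gamma> x i' k" if s: "serving k x" and i': "i' < m" for x i'
  proof -
    have sh: "shape (Suc k) x" using s unfolding serving_def by simp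
    have "S2 x \<le> (\<Sum>i<m. \<Sum>j<n. exp (\<mu> / \<Gamma>))"
      using shapeD(2)[OF sh] \<Gamma>_pos by (intro sum_mono) (simp add: divide_right_mono)
    then have "S2 x \<le> real m * real n * exp (\<mu> / \<Gamma>)" by (simp add: mult_ac)
    moreover have "1 \<le> exp (x i' k / \<Gamma>)"
      using shapeD(1)[OF sh i' assms(2)] \<Gamma>_pos by simp
    ultimately have "1 / (real m * real n * exp (\<mu> / \<Gamma>)) \<le> sm2 x i' k"
      unfolding sm2_def using S2_pos[of x] by (intro frac_le) auto
    then have "lo \<le> Z * sm2 x i' k / \<Gamma>"
      unfolding lo_def using Z_pos \<Gamma>_pos by (intro divide_right_mono mult_left_mono) auto
    then show ?thesis using r_ge[OF i' assms(2), of x] by simp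
  qed
  have r_hi: "r Z \<Gamma> x i k \<le> hi" for x
    unfolding r_eq[OF assms] hi_def using assms sm1_le_1 sm2_le_1 c_nonneg \<Gamma>_pos
    by (intro add_mono R_mono) auto
  then have hi: "0 < hi" using r_pos[OF assms] by (rule less_le_trans[rotated])
  show thesis
  proof
    have "0 < (\<mu> - 1) * lo / hi" using \<mu>_gt_1 lo hi by simp
    then show "0 < ln (1 + (\<mu> - 1) * lo / hi)" by simp
    fix x assume s: "serving k x"
    have "lo \<le> (MIN i\<in>{..<m}. r Z \<Gamma> x i k)"
      using lo_le[OF s] index_ne by (subst Min_ge_iff) auto
    then have "(\<mu> - 1) * lo \<le> eps Z \<Gamma> x k"
      unfolding eps_def using \<mu>_gt_1 by (intro mult_left_mono) auto
    then have "(\<mu> - 1) * lo / hi \<le> rate k x i"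
      using r_hi r_pos[OF assms] eps_pos[OF assms(2), of x] by (intro frac_le) (auto simp: less_imp_le)
    then show "ln (1 + (\<mu> - 1) * lo / hi) \<le> ln (1 + rate k x i)"
      using \<open>0 < (\<mu> - 1) * lo / hi\<close> by (subst ln_le_cancel_iff) auto
  qed
qed

lemma allowed_nonempty: assumes "k < n" obtains i where "i \<in> allowed Z k"
proof (cases "\<exists>i. i \<in> allowed Z k")
  case False
  then have "(\<Sum>i<m. xs i k) = 0" using feasD(8)[OF _ assms] by simp
  then show thesis using feasD(1)[OF assms] by simp
qed (use that in auto)

lemma serve_returns:
  assumes s: "served k x" and k: "k < n"
  obtains x' where "serve Z \<Gamma> k x = Return x'" "served (Suc k) x'"
proof -
  obtain i where i: "i \<in> allowed Z k" using allowed_nonempty[OF k] .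
  obtain \<delta> where \<delta>: "0 < \<delta>" "\<And>x. serving k x \<Longrightarrow> \<delta> \<le> ln (1 + rate k x i)"
    using rate_lower_bound[OF allowedD(1)[OF i] k] by blast
  \<comment> \<open>Each phase raises the gain of this one allowed facility by at least
    \<open>\<delta>\<close>, and the gain never exceeds \<open>2 * Lg\<close>; the measure counts
    the steps of size \<open>\<delta>\<close> that are left.\<close>
  define f where "f x = nat \<lfloor>(2 * Lg - gain k x i) / \<delta>\<rfloor>" for x
  have dec: "f (phase Z \<Gamma> k x) < f x" if s: "serving k x" and less: "(\<Sum>i<m. x i k) < 1" for x
  proof -
    let ?x' = "phase Z \<Gamma> k x"
    have "0 < x i k"
      using s i x0_pos[OF allowedD(1)[OF i] k] by (force simp: serving_def)
    then have "gain k x i + \<delta> \<le> gain k ?x' i" using gain_step[OF i k, of x] \<delta>(2)[OF s] by linarith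
    then have "(2 * Lg - gain k ?x' i + \<delta>) / \<delta> \<le> (2 * Lg - gain k x i) / \<delta>"
      using \<delta>(1) by (intro divide_right_mono) auto
    then have "(2 * Lg - gain k ?x' i) / \<delta> + 1 \<le> (2 * Lg - gain k x i) / \<delta>"
      using \<delta>(1) by (simp add: add_divide_distrib)
    \<comment> \<open>\<open>nat\<close> sends negative floors to 0, so strict descent needs the
      bound on the gain after the phase as well.\<close>
    moreover have "0 \<le> (2 * Lg - gain k ?x' i) / \<delta>"
      using gain_le[OF phase_serving[OF s k less] k i] \<delta>(1) by simp
    ultimately show ?thesis unfolding f_def by linarith
  qed
  define b where "b = (\<lambda>(x :: matrix, failed). \<not> failed \<and> (\<Sum>i<m. x i k) < 1)"
  define step where "step = (\<lambda>(x, _::bool). let x' = phase Z \<Gamma> k x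
    in (x', cost Z \<Gamma> x' > 5 * Z * ln (exp 1 * real m * real n)))"
  have no_fail: "cost Z \<Gamma> x \<le> 5 * Z * ln (exp 1 * real m * real n)" if "serving k x" for x
  proof -
    obtain P Q where "tracks P Q x" "cost Z \<Gamma> x \<le> spent (Suc k) (Suc k) P Q x"
      using serving_spent[OF \<open>serving k x\<close> k] .
    then show ?thesis using that k by (intro cost_le[of P Q x "Suc k"]) (auto simp: serving_def)
  qed
  define good where "good t \<longleftrightarrow> serving k (fst t) \<and> \<not> snd t" for t :: "matrix \<times> bool"
  have good: "good (step t) \<and> f (fst (step t)) < f (fst t)" if "good t" "b t" for t
  proof -
    have t: "serving k (fst t)" "(\<Sum>i<m. fst t i k) < 1" using that by (auto simp: b_def good_def)
    have "serving k (phase Z \<Gamma> k (fst t))" using t k by (intro phase_serving)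
    then show ?thesis
      using no_fail[of "phase Z \<Gamma> k (fst t)"] dec[OF t]
      by (auto simp: step_def Let_def split_beta good_def)
  qed
  have init: "good (arrive Z k x, False)" using arrive_serving[OF s k] by (simp add: good_def)
  obtain t where t: "while_option b step (arrive Z k x, False) = Some t"
    using measure_while_option_Some[where P = good and f = "\<lambda>t. f (fst t)", OF good init] by blast
  have "good t" using while_option_rule[where P = good, OF _ t init] good by blast
  moreover have "\<not> b t" using while_option_stop[OF t] .
  moreover obtain x' failed where "t = (x', failed)" by (cases t)
  ultimately have w: "while_option b step (arrive Z k x, False) = Some (x', False)"
    and x': "serving k x'" "\<not> b (x', False)" using t by (auto simp: good_def)
  have "serve Z \<Gamma> k x = Return x'"
    using w unfolding serve_def b_def step_def by simp
  moreover have "served (Suc k) x'"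
    using x' k by (intro serving_served) (auto simp: b_def)
  ultimately show thesis by (rule that)
qed

lemma run_returns: "k \<le> n \<Longrightarrow> \<exists>x. run Z \<Gamma> k = Return x \<and> served k x"
proof (induction k)
  case 0
  then show ?case using served_0 by simp
next
  case (Suc k)
  then obtain x where x: "run Z \<Gamma> k = Return x" "served k x" by auto
  obtain x' where "serve Z \<Gamma> k x = Return x'" "served (Suc k) x'"
    using serve_returns[OF x(2)] Suc.prems by auto
  with x show ?case by auto
qed

text \<open>Each logarithm in \<open>\<Phi>\<close> dominates every exponent of its family. Thus the
  term \<open>Z * \<Phi>\<close> of the cost pays for \<open>Z * lam_til\<close>.\<close>

lemma y_til_le_\<Phi>:
  assumes "i < m" shows "y_til Z \<Gamma> x i \<le> \<Phi> Z \<Gamma> x"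
proof -
  have "exp (v_til Z \<Gamma> x i) \<le> S1 x" using assms by (intro member_le_sum) auto
  then have 1: "v_til Z \<Gamma> x i \<le> ln (S1 x)" using S1_pos[of x] by (subst ln_ge_iff) auto
  have "peak x i \<in> x i ` {..<n}" using index_ne by (intro Max_in) auto
  then obtain j where "j < n" "peak x i = x i j" by auto
  then have "exp (w_til \<Gamma> x i) \<le> S2 x" using exp_entry_le_S2[of i j x] assms by (simp add: w_til_def)
  then have "w_til \<Gamma> x i \<le> ln (S2 x)" using S2_pos[of x] by (subst ln_ge_iff) auto
  with 1 show ?thesis unfolding y_til_def \<Phi>_eq by simp
qed

lemma assign_returns:
  obtains x where "assign Z \<Gamma> = Return x"
    "LP1_feasible Z x (\<lambda>i. \<Gamma> * y_til Z \<Gamma> x i) (max 1 (\<Gamma> * lam_til Z \<Gamma> x))"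
    "LP1_cost Z x (\<lambda>i. \<Gamma> * y_til Z \<Gamma> x i) (max 1 (\<Gamma> * lam_til Z \<Gamma> x))
      \<le> Z + Z * \<Gamma> * (5 * ln (exp 1 * real m * real n))"
proof -
  obtain x where x: "run Z \<Gamma> n = Return x" "served n x" using run_returns[of n] by auto
  have sh: "shape n x" and cover: "\<And>j. j < n \<Longrightarrow> 1 \<le> (\<Sum>i<m. x i j)" using x(2) unfolding served_def by auto
  have cost: "cost Z \<Gamma> x \<le> 5 * Z * ln (exp 1 * real m * real n)"
    using x(2) cost_le unfolding served_def by auto
  have y: "\<Gamma> * y_til Z \<Gamma> x i = (\<Sum>j<n. p i j * x i j) / Z + peak x i" for i
    unfolding y_til_def distrib_left \<Gamma>_w_til v_til_def using \<Gamma>_pos by simp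
  have load: "0 \<le> (\<Sum>j<n. p i j * x i j) / Z" if "i < m" for i
    using shapeD(1)[OF sh that] p_nonneg[OF that] Z_pos
    by (intro divide_nonneg_pos sum_nonneg) auto
  have peak: "0 \<le> peak x i" if "i < m" for i
    using order_trans[OF shapeD(1)[OF sh that, of 0] peak_ge[of 0 x i]] n_ge_2 by simp
  have lam: "y_til Z \<Gamma> x i \<le> lam_til Z \<Gamma> x" if "i < m" for i
    unfolding lam_til_def using that by (intro Max_ge) auto
  have "LP1_feasible Z x (\<lambda>i. \<Gamma> * y_til Z \<Gamma> x i) (max 1 (\<Gamma> * lam_til Z \<Gamma> x))"
    unfolding LP1_feasible_def
  proof (intro conjI allI impI)
    fix i assume i: "i < m"
    show "\<Gamma> * y_til Z \<Gamma> x i \<le> max 1 (\<Gamma> * lam_til Z \<Gamma> x)"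
      using lam[OF i] \<Gamma>_pos by (intro max.coboundedI2 mult_left_mono) auto
    show "0 \<le> \<Gamma> * y_til Z \<Gamma> x i" unfolding y using load[OF i] peak[OF i] by simp
    show "(\<Sum>j<n. p i j * x i j) \<le> Z * (\<Gamma> * y_til Z \<Gamma> x i)"
      unfolding y using peak[OF i] Z_pos by (simp add: distrib_left)
    fix j assume j: "j < n"
    show "x i j \<le> \<Gamma> * y_til Z \<Gamma> x i"
      unfolding y using load[OF i] peak_ge[OF j, of x i] by linarith
    show "0 \<le> x i j" "i \<notin> allowed Z j \<Longrightarrow> x i j = 0" using shapeD[OF sh i j] by auto
  qed (use cover in auto)
  moreover have "LP1_cost Z x (\<lambda>i. \<Gamma> * y_til Z \<Gamma> x i) (max 1 (\<Gamma> * lam_til Z \<Gamma> x))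
      \<le> Z + Z * \<Gamma> * (5 * ln (exp 1 * real m * real n))"
  proof -
    have lam\<Phi>: "lam_til Z \<Gamma> x \<le> \<Phi> Z \<Gamma> x"
      unfolding lam_til_def using y_til_le_\<Phi> index_ne by (subst Max_le_iff) auto
    have "0 \<le> \<Gamma> * y_til Z \<Gamma> x 0" unfolding y using load[of 0] peak[of 0] m_ge_2 by simp
    then have "0 \<le> y_til Z \<Gamma> x 0" using \<Gamma>_pos by (simp add: zero_le_mult_iff)
    then have "0 \<le> lam_til Z \<Gamma> x" using lam[of 0] m_ge_2 by simp
    then have "max 1 (\<Gamma> * lam_til Z \<Gamma> x) \<le> 1 + \<Gamma> * lam_til Z \<Gamma> x" using \<Gamma>_pos by simp
    also have "\<dots> \<le> 1 + \<Gamma> * \<Phi> Z \<Gamma> x" using lam\<Phi> \<Gamma>_pos by simp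
    finally have "Z * max 1 (\<Gamma> * lam_til Z \<Gamma> x) \<le> Z * (1 + \<Gamma> * \<Phi> Z \<Gamma> x)"
      using Z_pos by (intro mult_left_mono) auto
    \<comment> \<open>The extra \<open>Z\<close> pays for the 1 in \<open>max 1\<close>; all other
      terms are \<open>\<Gamma>\<close> times terms of \<open>cost\<close>.\<close>
    then have "LP1_cost Z x (\<lambda>i. \<Gamma> * y_til Z \<Gamma> x i) (max 1 (\<Gamma> * lam_til Z \<Gamma> x))
        \<le> Z + \<Gamma> * cost Z \<Gamma> x"
      unfolding LP1_cost_def cost_def using \<Gamma>_pos
      by (simp add: algebra_simps sum_distrib_left)
    also have "\<Gamma> * cost Z \<Gamma> x \<le> \<Gamma> * (5 * Z * ln (exp 1 * real m * real n))"
      using cost \<Gamma>_pos by (intro mult_left_mono) auto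
    finally show ?thesis by (simp add: mult_ac)
  qed
  ultimately show thesis using x(1) that unfolding assign_def by blast
qed

end

section \<open>From the run to the competitive bound\<close>

theorem theorem28:
  shows "\<exists>C::real. \<forall>(m::nat) (n::nat) (c::nat \<Rightarrow> real) (p::matrix) (a::matrix) (Z::real) (\<Gamma>::real).
    ccfl m n c p a \<longrightarrow> Z > 0 \<longrightarrow>
    (\<exists>x y l. ccfl.LP1_feasible m n c p a Z x y l) \<longrightarrow>
    2 * (ccfl.OPT1 m n c p a Z / Z) \<ge> \<Gamma> / (2 * ccfl.\<sigma> m n c p a) \<longrightarrow>
    \<Gamma> / (2 * ccfl.\<sigma> m n c p a) \<ge> ccfl.OPT1 m n c p a Z / Z \<longrightarrow>
    (\<exists>x. ccfl.assign m n c p a Z \<Gamma> = Return x \<and>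
      (let y = (\<lambda>i. \<Gamma> * ccfl.y_til n p Z \<Gamma> x i);
           l = max 1 (\<Gamma> * ccfl.lam_til m n p Z \<Gamma> x)
       in ccfl.LP1_feasible m n c p a Z x y l \<and>
          ccfl.LP1_cost m n c a Z x y l
            \<le> C * ln (real m * real n) * ln (real m * real n * ccfl.\<rho> m n c p a)
                * ccfl.OPT1 m n c p a Z))"
\<comment> \<open>With \<open>A\<close> and \<open>B\<close> as defined below,
  \<open>4 * \<sigma> \<le> 144 * Lg \<le> 288 * B\<close> and
  \<open>5 * ln (exp 1 * m * n) \<le> 10 * A\<close> give 2880; the extra \<open>Z\<close> gives
  1.\<close>
proof (rule exI[of _ 2881], intro allI impI)
  fix m n c p a and Z \<Gamma> :: real
  assume "ccfl m n c p a" and Z: "0 < Z"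
    and ex: "\<exists>x y l. ccfl.LP1_feasible m n c p a Z x y l"
    and ub: "2 * (ccfl.OPT1 m n c p a Z / Z) \<ge> \<Gamma> / (2 * ccfl.\<sigma> m n c p a)"
    and lb: "\<Gamma> / (2 * ccfl.\<sigma> m n c p a) \<ge> ccfl.OPT1 m n c p a Z / Z"
  interpret ccfl m n c p a by fact
  let ?costs = "{LP1_cost Z x y l | x y l. LP1_feasible Z x y l}"
  have ge: "Z \<le> LP1_cost Z x y l" if "LP1_feasible Z x y l" for x y l
  proof -
    have "Z * 1 \<le> Z * l" using that Z by (intro mult_left_mono) (auto simp: LP1_feasible_def)
    moreover have "0 \<le> (\<Sum>i<m. c i * y i)" "0 \<le> (\<Sum>i<m. \<Sum>j<n. a i j * x i j)"
      using that c_nonneg a_nonneg by (auto simp: LP1_feasible_def intro!: sum_nonneg)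
    ultimately show ?thesis unfolding LP1_cost_def by simp
  qed
  have ne: "?costs \<noteq> {}" using ex by auto
  have OPT: "Z \<le> OPT1 Z" unfolding OPT1_def using ne ge by (intro cInf_greatest) auto
  \<comment> \<open>Positivity of the infimum yields a solution within factor 2 of it. The budget
    survives this loss because \<open>16 * Lg \<le> \<sigma>\<close> and
    \<open>2 * \<sigma> * OPT1 Z \<le> Z * \<Gamma>\<close>.\<close>
  then have "OPT1 Z < 2 * OPT1 Z" using Z by simp
  then obtain V where "V \<in> ?costs" "V < 2 * OPT1 Z"
    unfolding OPT1_def using cInf_lessD[OF ne] by blast
  then obtain xs ys ls where feas: "LP1_feasible Z xs ys ls" and
    V: "LP1_cost Z xs ys ls < 2 * OPT1 Z" by auto
  have Lg: "1 \<le> Lg" by (rule Lg_ge_1)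
  have e: "2 \<le> exp (1::real)" "exp (1::real) \<le> 3" using exp_ge_add_one_self[of "1::real"] exp_le by auto
  have e2: "4 \<le> (exp (1::real))\<^sup>2" "(exp (1::real))\<^sup>2 \<le> 9"
    using power_mono[OF e(1), of 2] power_mono[OF e(2), of 2] by auto
  have \<sigma>: "16 * Lg \<le> \<sigma>" "\<sigma> \<le> 36 * Lg"
    unfolding \<sigma>_def using e2 Lg by (auto intro!: mult_right_mono)
  have "0 < \<sigma>" using \<sigma> Lg by linarith
  then have Z\<Gamma>: "2 * \<sigma> * OPT1 Z \<le> Z * \<Gamma>" "Z * \<Gamma> \<le> 4 * \<sigma> * OPT1 Z"
    using ub lb Z by (simp_all add: field_simps)
  have "16 * Lg * LP1_cost Z xs ys ls \<le> \<sigma> * (2 * OPT1 Z)"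
    using \<sigma> Lg V ge[OF feas] Z by (intro mult_mono) auto
  also have "\<dots> = 2 * \<sigma> * OPT1 Z" by simp
  also note Z\<Gamma>(1)
  finally have "16 * Lg * LP1_cost Z xs ys ls \<le> Z * \<Gamma>" .
  then interpret ccfl_run m n c p a Z \<Gamma> xs ys ls
    using Z feas by unfold_locales
  obtain x where x: "assign Z \<Gamma> = Return x"
    "LP1_feasible Z x (\<lambda>i. \<Gamma> * y_til Z \<Gamma> x i) (max 1 (\<Gamma> * lam_til Z \<Gamma> x))"
    "LP1_cost Z x (\<lambda>i. \<Gamma> * y_til Z \<Gamma> x i) (max 1 (\<Gamma> * lam_til Z \<Gamma> x))
      \<le> Z + Z * \<Gamma> * (5 * ln (exp 1 * real m * real n))"
    using assign_returns by blast
  define A where "A = ln (real m * real n)"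
  define B where "B = ln (real m * real n * \<rho>)"
  have A: "1 \<le> A" unfolding A_def by (rule ln_mn_ge_1)
  have pos: "0 < real m * real n" using mn_ge_4 by linarith
  have "A \<le> B" unfolding A_def B_def using pos \<rho>_ge_1
    by (intro ln_mono) (auto simp: mult_le_cancel_left1)
  then have B: "1 \<le> B" using A by simp
  have "Lg = ln (2 * \<mu>) + B"
    unfolding B_def using m_ge_2 n_ge_2 \<rho>_ge_1 \<mu>_gt_1 by (simp add: ln_mult)
  \<comment> \<open>\<open>2 * \<mu> \<le> 4 \<le> m * n\<close>, so the factor
    \<open>2 * \<mu>\<close> inside \<open>Lg\<close> at most doubles the logarithm.\<close>
  also have "ln (2 * \<mu>) \<le> A"
    unfolding A_def using \<mu>_le_2 \<mu>_gt_1 mn_ge_4 by (intro ln_mono) auto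
  finally have LgB: "Lg \<le> 2 * B" using \<open>A \<le> B\<close> by simp
  have "Z * \<Gamma> * (5 * ln (exp 1 * real m * real n)) \<le> 288 * B * OPT1 Z * (10 * A)"
  proof (rule mult_mono)
    have "4 * \<sigma> \<le> 288 * B" using \<sigma> LgB by linarith
    then have "4 * \<sigma> * OPT1 Z \<le> 288 * B * OPT1 Z" using OPT Z by (intro mult_right_mono) auto
    then show "Z * \<Gamma> \<le> 288 * B * OPT1 Z" using Z\<Gamma> by simp
    show "5 * ln (exp 1 * real m * real n) \<le> 10 * A" unfolding ln_emn using A by (simp add: A_def)
    show "0 \<le> 288 * B * OPT1 Z" using B OPT Z by simp
    show "0 \<le> 5 * ln (exp 1 * real m * real n)" unfolding ln_emn using A by (simp add: A_def)
  qed
  moreover have "1 * Z \<le> (A * B) * OPT1 Z"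
    using A B OPT Z mult_mono[of 1 A 1 B] by (intro mult_mono) auto
  ultimately have "LP1_cost Z x (\<lambda>i. \<Gamma> * y_til Z \<Gamma> x i) (max 1 (\<Gamma> * lam_til Z \<Gamma> x))
      \<le> 2881 * A * B * OPT1 Z"
    using x(3) by (simp add: mult_ac)
  then show "\<exists>x. assign Z \<Gamma> = Return x \<and>
      (let y = (\<lambda>i. \<Gamma> * y_til Z \<Gamma> x i); l = max 1 (\<Gamma> * lam_til Z \<Gamma> x)
       in LP1_feasible Z x y l \<and>
          LP1_cost Z x y l \<le> 2881 * ln (real m * real n) * ln (real m * real n * \<rho>) * OPT1 Z)"
    using x(1,2) unfolding A_def B_def by (auto simp: Let_def)
qed

end
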